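(* Let $a>0$, $m\in\mathbb R$ with $M=\frac13(m^2-a^4-2a^{-2})=0$, and let $f=(x_1,x_2,x_3)^t$ be the hyperbolic affine sphere obtained from the Delaunay-type potential at $\lambda=-i$ (see context). Then for $t=x+iy$ with $x\in\mathbb R\setminus\tilde\Lambda$, $y\in\mathbb R$, $$x_1=\frac{\sigma(x+\beta-\alpha)}{\sigma(x+\beta)}e^{\zeta(\alpha)x}\{A_2(x^2+y^2)+B_2(x)\},$$ $$x_2=\frac{\sigma(x+\beta-\alpha)}{\sigma(x+\beta)}e^{\zeta(\alpha)x}\{C_2(x^2+y^2)+D_2y+E_2(x)\},$$ $$x_3=\frac{\sigma(x+\beta-\alpha)}{\sigma(x+\beta)}e^{\zeta(\alpha)x}\{C_2(x^2+y^2)-D_2y+E_2(x)\},$$ where $$A_2=\frac{(m+a^2+2a^{-1})(m-a^2)\sigma(\beta)}{2\sqrt3\,\sigma(\beta-\alpha)},\quad C_2=\frac{(m+a^2-a^{-1})(m-a^2)\sigma(\beta)}{2\sqrt3\,\sigma(\beta-\alpha)},\quad D_2=\frac{\sigma(\beta)}{a\,\sigma(\beta-\alpha)},$$ $$B_2(x)=\frac{\sigma(\beta)}{\sqrt3\,\sigma(\beta-\alpha)}\left\{1-(m+a^2+2a^{-1})x+4a^2(m+a^2+2a^{-1})q(x)\left(\frac{\sigma(\beta-\alpha)}{\sigma(\beta)}\right)^3\right\},$$ $$E_2(x)=\frac{\sigma(\beta)}{\sqrt3\,\sigma(\beta-\alpha)}\left\{1-(m+a^2-a^{-1})x+4a^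2(m+a^2-a^{-1})q(x)\left(\frac{\sigma(\beta-\alpha)}{\sigma(\beta)}\right)^3\right\}.$$
   Context: $\wp$ is the Weierstrass elliptic function with $(\wp_t)^2=4\wp^3+16$, with fundamental periods $\omega_1,\omega_2$; $\zeta,\sigma$ are the Weierstrass functions of the same lattice ($\zeta'=-\wp$, $\sigma'/\sigma=\zeta$). Fix $\alpha,\beta\in\mathbb C$ with $\wp(\beta)=2a^{-2}$, $\wp_t(\beta)=4a^{-2}m$, $\wp(\alpha)=0$, $\wp_t(\alpha)=4$. $\tilde\Lambda=\{x\in\mathbb C\mid x+\beta\in\omega_1\mathbb Z+\omega_2\mathbb Z\text{ or }\wp(x+\beta)=0\}$, and $$q(t)=\int_0^t(t-s)\left(\frac{\sigma(s+\beta)}{\sigma(s+\beta-\alpha)}\right)^3e^{-3\zeta(\alpha)s}\,ds,$$ the integral being along a path in $\mathbb C\setminus\tilde\Lambda$. The surface at $\lambda=-i$: let $X=\begin{pmatrix} m & -a^{-1} & a^2 \\ a^{-1} & 0 & -a^{-1} \\ -a^2 & a^{-1} & -m \end{pmatrix}$ (the Delaunay-type potential matrix $\begin{pmatrix} m & \lambda^{-1}ia^{-1} & \lambda ia^2 \\ \lambda ia^{-1} & 0 & \lambda^{-1}ia^{-1} \\ \lambda^{-1}ia^2 & \lambda ia^{-1} & -m \end{pmatrix}$ at $\lambda=-i$), and let $\tilde\Phi_+^{-1}(t)$ be the holomorphic solution on $\mathbb C\setminus\tilde\Lambda$ of $$(\tilde\Phi_+^{-1})_t=\tilde\Phi_+^{-1}\begin{pmatrix}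 -\frac{\wp_t(t+\beta)}{\wp(t+\beta)} & 0 & -2a^2 \\ -2a^{-1} & 0 & 0 \\ 0 & -2a^{-1} & \frac{\wp_t(t+\beta)}{\wp(t+\beta)} \end{pmatrix},\quad\tilde\Phi_+^{-1}(0)=I_3.$$ With $\omega=e^{2\pi i/3}$ and $T=\frac1{\sqrt3}\begin{pmatrix} 1 & 1 & 1 \\ \omega & 1 & \omega^2 \\ \omega^2 & 1 & \omega \end{pmatrix}$, the surface is $f(x+iy)=T\exp((x+iy)X)\,\tilde\Phi_+^{-1}(x)\,(0,1,0)^t$. *)

theory Defs
  imports "HOL-Complex_Analysis.Complex_Analysis"
begin

unbundle no fps_syntax

section \<open>Weierstrass functions of a lattice\<close>

definition period_lattice :: "complex \<Rightarrow> complex \<Rightarrow> complex set" where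
  "period_lattice \<omega>1 \<omega>2 = {of_int k * \<omega>1 + of_int l * \<omega>2 | k l. True}"

definition fundamental_periods :: "complex \<Rightarrow> complex \<Rightarrow> bool" where
  "fundamental_periods \<omega>1 \<omega>2 \<longleftrightarrow> \<omega>1 \<noteq> 0 \<and> \<omega>2 / \<omega>1 \<notin> \<real>"

text \<open>
  The values of \<open>weierstrass_p\<close> and \<open>weierstrass_zeta\<close> at lattice points carry no meaning.
\<close>

definition weierstrass_p :: "complex \<Rightarrow> complex \<Rightarrow> complex \<Rightarrow> complex" where
  "weierstrass_p \<omega>1 \<omega>2 z =
     1 / z^2 + (\<Sum>\<^sub>\<infinity>w\<in>period_lattice \<omega>1 \<omega>2 - {0}. 1 / (z - w)^2 - 1 / w^2)"

definition weierstrass_zeta :: "complex \<Rightarrow> complex \<Rightarrow> complex \<Rightarrow> complex" where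
  "weierstrass_zeta \<omega>1 \<omega>2 z =
     1 / z + (\<Sum>\<^sub>\<infinity>w\<in>period_lattice \<omega>1 \<omega>2 - {0}. 1 / (z - w) + 1 / w + z / w^2)"

text \<open>
  The infinite product over the nonzero lattice points is the limit of its finite partial
  products, in the same sense in which \<^const>\<open>infsum\<close> is the limit of finite partial sums.
\<close>

definition weierstrass_sigma :: "complex \<Rightarrow> complex \<Rightarrow> complex \<Rightarrow> complex" where
  "weierstrass_sigma \<omega>1 \<omega>2 z =
     z * Lim (finite_subsets_at_top (period_lattice \<omega>1 \<omega>2 - {0}))
           (\<lambda>F. \<Prod>w\<in>F. (1 - z / w) * exp (z / w + z^2 / (2 * w^2)))"


section \<open>Complex 3 by 3 matrices\<close>

text \<open>
  The type class operations \<open>*\<close> and \<open>^\<close> on \<^typ>\<open>complex^3^3\<close> are componentwise, so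
  scalar multiples, powers and the exponential series are introduced here via \<open>**\<close>.
\<close>

definition cscale :: "complex \<Rightarrow> complex^3^3 \<Rightarrow> complex^3^3" where
  "cscale c A = (\<chi> i j. c * A $ i $ j)"

primrec mat_power :: "complex^3^3 \<Rightarrow> nat \<Rightarrow> complex^3^3" where
  "mat_power A 0 = mat 1"
| "mat_power A (Suc n) = A ** mat_power A n"

definition mat_exp :: "complex^3^3 \<Rightarrow> complex^3^3" where
  "mat_exp A = (\<Sum>n. cscale (1 / fact n) (mat_power A n))"


section \<open>The surface\<close>

definition delaunay_potential :: "real \<Rightarrow> real \<Rightarrow> complex \<Rightarrow> complex^3^3" where
  "delaunay_potential a m l = (let a = complex_of_real a; m = complex_of_real m in
     vector [
       vector [m, \<i> / (l * a), l * \<i> * a^2],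
       vector [l * \<i> / a, 0, \<i> / (l * a)],
       vector [\<i> * a^2 / l, l * \<i> / a, - m]])"

definition X_matrix :: "real \<Rightarrow> real \<Rightarrow> complex^3^3" where
  "X_matrix a m = (let a = complex_of_real a; m = complex_of_real m in
     vector [
       vector [m, - 1 / a, a^2],
       vector [1 / a, 0, - 1 / a],
       vector [- (a^2), 1 / a, - m]])"

lemma delaunay_potential_minus_i: "delaunay_potential a m (- \<i>) = X_matrix a m"
  by (simp add: delaunay_potential_def X_matrix_def Let_def field_simps)

definition T_matrix :: "complex^3^3" where
  "T_matrix = (let w = exp (2 * of_real pi * \<i> / 3) in
     cscale (1 / of_real (sqrt 3))
       (vector [
         vector [1, 1, 1],
         vector [w, 1, w^2],
         vector [w^2, 1, w]]))"

definition Lambda_tilde :: "complex \<Rightarrow> complex \<Rightarrow> complex \<Rightarrow> complex set" where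
  "Lambda_tilde \<omega>1 \<omega>2 \<beta> =
     {x. x + \<beta> \<in> period_lattice \<omega>1 \<omega>2 \<or> weierstrass_p \<omega>1 \<omega>2 (x + \<beta>) = 0}"

text \<open>Coefficient matrix of the linear equation for \<open>Phi\<close>, the inverse of the positive factor.\<close>

definition frame_coeff :: "complex \<Rightarrow> complex \<Rightarrow> complex \<Rightarrow> real \<Rightarrow> complex \<Rightarrow> complex^3^3" where
  "frame_coeff \<omega>1 \<omega>2 \<beta> a t =
     (let a = complex_of_real a;
          u = deriv (weierstrass_p \<omega>1 \<omega>2) (t + \<beta>) / weierstrass_p \<omega>1 \<omega>2 (t + \<beta>)
      in vector [
           vector [- u, 0, - 2 * a^2],
           vector [- 2 / a, 0, 0],
           vector [0, - 2 / a, u]])"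

definition is_frame ::
    "complex \<Rightarrow> complex \<Rightarrow> complex \<Rightarrow> real \<Rightarrow> (complex \<Rightarrow> complex^3^3) \<Rightarrow> bool" where
  "is_frame \<omega>1 \<omega>2 \<beta> a Phi \<longleftrightarrow>
     (\<forall>t. t \<notin> Lambda_tilde \<omega>1 \<omega>2 \<beta> \<longrightarrow>
        (\<forall>i j. ((\<lambda>s. Phi s $ i $ j) has_field_derivative
                 (Phi t ** frame_coeff \<omega>1 \<omega>2 \<beta> a t) $ i $ j) (at t))) \<and>
     Phi 0 = mat 1"

definition surface :: "real \<Rightarrow> real \<Rightarrow> (complex \<Rightarrow> complex^3^3) \<Rightarrow> complex \<Rightarrow> complex^3" where
  "surface a m Phi z =
     (T_matrix ** mat_exp (cscale z (X_matrix a m)) ** Phi (of_real (Re z))) *v vector [0, 1, 0]"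

definition q_integrand ::
    "complex \<Rightarrow> complex \<Rightarrow> complex \<Rightarrow> complex \<Rightarrow> complex \<Rightarrow> complex \<Rightarrow> complex" where
  "q_integrand \<omega>1 \<omega>2 \<alpha> \<beta> t s =
     (t - s)
     * (weierstrass_sigma \<omega>1 \<omega>2 (s + \<beta>) / weierstrass_sigma \<omega>1 \<omega>2 (s + \<beta> - \<alpha>)) ^ 3
     * exp (- 3 * weierstrass_zeta \<omega>1 \<omega>2 \<alpha> * s)"

text \<open>
  Each value \<open>q t\<close> is the integral along some path from \<open>0\<close> to \<open>t\<close> avoiding \<open>Lambda_tilde\<close>;
  the path may be chosen arbitrarily for every \<open>t\<close>.
\<close>

definition is_q ::
    "complex \<Rightarrow> complex \<Rightarrow> complex \<Rightarrow> complex \<Rightarrow> (complex \<Rightarrow> complex) \<Rightarrow> bool" where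
  "is_q \<omega>1 \<omega>2 \<alpha> \<beta> q \<longleftrightarrow>
     (\<forall>t. t \<notin> Lambda_tilde \<omega>1 \<omega>2 \<beta> \<longrightarrow>
        (\<exists>\<gamma>. valid_path \<gamma> \<and> pathstart \<gamma> = 0 \<and> pathfinish \<gamma> = t \<and>
             path_image \<gamma> \<inter> Lambda_tilde \<omega>1 \<omega>2 \<beta> = {} \<and>
             (q_integrand \<omega>1 \<omega>2 \<alpha> \<beta> t has_contour_integral q t) \<gamma>))"

end

theory Submission
  imports Defs
begin

text \<open>
  Let \<open>p = (p1, p2, p3)\<close> be a row of the frame. Eliminating \<open>p1\<close> and \<open>p3\<close> from the linear
  system and using \<open>\<wp>'' = 6 \<wp>\<^sup>2\<close> gives \<open>p2''' = 6 \<wp>(t + \<beta>) p2' - 8 p2\<close>. One solution is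
  \<open>G(t) = \<sigma>(t + \<beta> - \<alpha>) / \<sigma>(t + \<beta>) exp(\<zeta>(\<alpha>) t)\<close>, the function \<open>lame\<close>. Its logarithmic derivative is
  \<open>\<zeta>(s - \<alpha>) - \<zeta>(s) + \<zeta>(\<alpha>)\<close> at \<open>s = t + \<beta>\<close>; by the addition theorem, \<open>\<wp>(\<alpha>) = 0\<close> and
  \<open>\<wp>'(\<alpha>) = 4\<close> this is \<open>\<phi> = (\<wp>' + 4) / (2 \<wp>)\<close>, which satisfies the Riccati equation
  \<open>\<phi>' = 2 \<wp> - \<phi>\<^sup>2\<close>, so that \<open>G'' = 2 \<wp> G\<close>. Substituting \<open>p2 = G w\<close> therefore
  cancels both the \<open>w\<close> and the \<open>w'\<close> terms of the third-order equation and leaves \<open>G w''' + 3 G' w'' = 0\<close>, that is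
  \<open>w'' = c / G\<^sup>3\<close>. Hence \<open>w\<close> is a combination of \<open>1\<close>, \<open>t\<close> and \<open>q\<close>, with coefficients read off
  at \<open>t = 0\<close> (lemmas \<open>frame_row_second_entry\<close> and \<open>frame_second_column\<close>).

  The characteristic polynomial of \<open>X\<close> is \<open>r\<^sup>3 - 3 M r\<close>, so \<open>M = 0\<close> makes \<open>X\<close> nilpotent and
  \<open>exp(z X)\<close> a quadratic polynomial in \<open>z\<close>. The part of the frame column that involves \<open>q\<close> lies in
  the kernel of \<open>X\<close>, and the rest combines to powers of \<open>x\<close> and \<open>y\<close> in which the quadratic part is
  \<open>z (z - 2 x) = - (x\<^sup>2 + y\<^sup>2)\<close> (lemma \<open>exp_z_is_quadratic\<close>).

  The addition theorem comes from an initial value problem: both \<open>\<phi>\<^sup>2 - \<wp>\<close> and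
  \<open>s \<mapsto> \<wp>(s - \<alpha>)\<close> are holomorphic near \<open>0\<close> and solve \<open>y'' = 6 y\<^sup>2\<close> with \<open>y(0) = 0\<close>,
  \<open>y'(0) = - 4\<close>, so they agree there, and then everywhere by analytic continuation
  (lemmas \<open>wp_shift\<close> and \<open>zeta_shift\<close>).

  The integral \<open>q\<close> is independent of the path because the integrand has a single-valued primitive,
  built from the entries of the frame.
\<close>

section \<open>Termwise differentiation and a uniqueness principle\<close>

text \<open>
  A dominated series of holomorphic functions converges uniformly, so Cauchy's formula passes to the limit.
  Summability of the derivatives is part of the conclusion, so that they require no estimates of their own.
\<close>
lemma infsum_has_field_derivative:
  fixes F F' :: "'a \<Rightarrow> complex \<Rightarrow> complex" and M :: "'a \<Rightarrow> real"
  assumes deriv: "\<And>w z. w \<in> A \<Longrightarrow> z \<in> S \<Longrightarrow> (F w has_field_derivative F' w z) (at z)"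
    and bound: "\<And>w z. w \<in> A \<Longrightarrow> z \<in> S \<Longrightarrow> norm (F w z) \<le> M w"
    and M: "M summable_on A" and "open S" and z: "z \<in> S"
  shows "(\<lambda>w. F w z) summable_on A" and "(\<lambda>w. F' w z) summable_on A"
    and "((\<lambda>z. \<Sum>\<^sub>\<infinity>w\<in>A. F w z) has_field_derivative (\<Sum>\<^sub>\<infinity>w\<in>A. F' w z)) (at z)"
proof -
  obtain r where r: "r > 0" "cball z r \<subseteq> S"
    using \<open>open S\<close> z open_contains_cball by blast
  show "(\<lambda>w. F w z) summable_on A"
    by (rule abs_summable_summable, rule summable_on_comparison_test[OF M])
      (use bound z in auto)
  have lim: "uniform_limit (cball z r) (\<lambda>X u. \<Sum>w\<in>X. F w u) (\<lambda>u. \<Sum>\<^sub>\<infinity>w\<in>A. F w u)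
               (finite_subsets_at_top A)"
    by (rule Weierstrass_m_test_general[OF _ M]) (use bound r in auto)
  have ev: "\<forall>\<^sub>F X in finite_subsets_at_top A. continuous_on (cball z r) (\<lambda>u. \<Sum>w\<in>X. F w u) \<and>
     (\<forall>u\<in>ball z r. ((\<lambda>u. \<Sum>w\<in>X. F w u) has_field_derivative (\<Sum>w\<in>X. F' w u)) (at u))"
  proof (rule eventually_finite_subsets_at_top_weakI)
    fix X assume X: "X \<subseteq> A"
    have d: "((\<lambda>u. \<Sum>w\<in>X. F w u) has_field_derivative (\<Sum>w\<in>X. F' w u)) (at u)"
      if "u \<in> cball z r" for u
      by (rule DERIV_sum) (use X r that in \<open>auto intro!: deriv\<close>)
    show "continuous_on (cball z r) (\<lambda>u. \<Sum>w\<in>X. F w u) \<and>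
     (\<forall>u\<in>ball z r. ((\<lambda>u. \<Sum>w\<in>X. F w u) has_field_derivative (\<Sum>w\<in>X. F' w u)) (at u))"
      using d by (meson DERIV_continuous_on ball_subset_cball has_field_derivative_at_within subsetD)
  qed
  obtain g' where g':
    "\<And>u. u \<in> ball z r \<Longrightarrow> ((\<lambda>u. \<Sum>\<^sub>\<infinity>w\<in>A. F w u) has_field_derivative g' u) (at u) \<and>
         ((\<lambda>X. \<Sum>w\<in>X. F' w u) \<longlongrightarrow> g' u) (finite_subsets_at_top A)"
    using has_complex_derivative_uniform_limit[OF ev lim _ r(1)] by auto
  have "((\<lambda>w. F' w z) has_sum g' z) A"
    using g'[of z] r(1) by (simp add: has_sum_def)
  moreover have "((\<lambda>z. \<Sum>\<^sub>\<infinity>w\<in>A. F w z) has_field_derivative g' z) (at z)"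
    using g'[of z] r(1) by simp
  ultimately show "(\<lambda>w. F' w z) summable_on A"
    "((\<lambda>z. \<Sum>\<^sub>\<infinity>w\<in>A. F w z) has_field_derivative (\<Sum>\<^sub>\<infinity>w\<in>A. F' w z)) (at z)"
    by (auto simp: has_sum_iff)
qed

text \<open>
  Every Taylor coefficient of \<open>d\<close> at \<open>0\<close> vanishes: by the Leibniz rule the derivative of order \<open>k + 2\<close>
  of \<open>d\<close> is a combination of derivatives of order at most \<open>k\<close>.
\<close>
lemma linear_ode2_zero:
  fixes d d1 h :: "complex \<Rightarrow> complex"
  assumes d1: "\<And>z. z \<in> ball 0 r \<Longrightarrow> (d has_field_derivative d1 z) (at z)"
    and d2: "\<And>z. z \<in> ball 0 r \<Longrightarrow> (d1 has_field_derivative h z * d z) (at z)"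
    and h: "h holomorphic_on ball 0 r" and "d 0 = 0" "d1 0 = 0" and z: "z \<in> ball 0 r"
  shows "d z = 0"
proof -
  have r: "r > 0" using z norm_ge_zero[of z] by (simp del: norm_ge_zero)
  have d: "d holomorphic_on ball 0 r"
    unfolding holomorphic_on_open[OF open_ball] using d1 by blast
  have ode: "deriv (deriv d) z = h z * d z" if z: "z \<in> ball 0 r" for z
  proof (rule DERIV_imp_deriv, rule has_field_derivative_transform_within_open[OF d2[OF z] open_ball z])
    show "d1 x = deriv d x" if "x \<in> ball 0 r" for x
      using DERIV_imp_deriv[OF d1[OF that]] by simp
  qed
  have init: "d 0 = 0" "deriv d 0 = 0"
    using assms(4,5) DERIV_imp_deriv[OF d1[of 0]] r by auto
  show ?thesis
  proof (rule holomorphic_fun_eq_0_on_ball[OF d z])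
    fix n
    show "(deriv ^^ n) d 0 = 0"
    proof (induction n rule: less_induct)
      case (less n)
      consider "n = 0" | "n = 1" | k where "n = Suc (Suc k)"
        by (metis One_nat_def not0_implies_Suc)
      then show ?case
      proof cases
        case 3
        have "(deriv ^^ n) d 0 = (deriv ^^ k) (deriv (deriv d)) 0"
          by (simp add: 3 funpow_swap1)
        also have "\<dots> = (deriv ^^ k) (\<lambda>z. h z * d z) 0"
          by (rule higher_deriv_transform_within_open[of _ "ball 0 r"])
            (use d h ode \<open>0 < r\<close> in \<open>auto intro!: holomorphic_intros\<close>)
        also have "\<dots> = (\<Sum>i = 0..k. of_nat (k choose i) * (deriv ^^ i) h 0 * (deriv ^^ (k - i)) d 0)"
          by (rule higher_deriv_mult[OF h d]) (use \<open>0 < r\<close> in auto)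
        also have "\<dots> = 0"
          by (rule sum.neutral) (use less.IH 3 in auto)
        finally show ?thesis .
      qed (use init in auto)
    qed
  qed
qed

section \<open>The period lattice\<close>

lemma summable_on_int_powr: "(\<lambda>k::int. (1 + \<bar>real_of_int k\<bar>) powr (-3/2)) summable_on UNIV"
proof -
  have "summable (\<lambda>n. real (Suc n) powr (-3/2))"
    using summable_real_powr_iff[of "-3/2"] by (subst summable_Suc_iff) auto
  then have n: "(\<lambda>n. (1 + real n) powr (-3/2)) summable_on (UNIV :: nat set)"
    by (subst summable_on_UNIV_nonneg_real_iff) (auto simp: add.commute)
  have 1: "(\<lambda>k::int. (1 + \<bar>real_of_int k\<bar>) powr (-3/2)) summable_on range int"
    by (subst summable_on_reindex) (use n in \<open>auto simp: o_def\<close>)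
  have 2: "(\<lambda>k::int. (1 + \<bar>real_of_int k\<bar>) powr (-3/2)) summable_on range (\<lambda>n. - int n)"
    by (subst summable_on_reindex) (use n in \<open>auto simp: o_def inj_def\<close>)
  have "(UNIV :: int set) = range int \<union> range (\<lambda>n. - int n)"
    by (auto simp: image_iff) (metis int_cases2)
  then show ?thesis
    using summable_on_union[OF 1 2] by simp
qed

locale lattice =
  fixes \<omega>1 \<omega>2 :: complex
  assumes periods: "fundamental_periods \<omega>1 \<omega>2"
begin

abbreviation L where "L \<equiv> period_lattice \<omega>1 \<omega>2"
abbreviation L0 where "L0 \<equiv> L - {0}"
abbreviation wp where "wp \<equiv> weierstrass_p \<omega>1 \<omega>2"
abbreviation zet where "zet \<equiv> weierstrass_zeta \<omega>1 \<omega>2"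
abbreviation sig where "sig \<equiv> weierstrass_sigma \<omega>1 \<omega>2"

lemma zero_in_L: "0 \<in> L"
  unfolding period_lattice_def by (rule CollectI, rule exI[of _ 0], rule exI[of _ 0]) simp

lemma uminus_L: "w \<in> L \<Longrightarrow> - w \<in> L"
  unfolding period_lattice_def
  by clarify (rule_tac x = "-k" in exI, rule_tac x = "-l" in exI, simp)

lemma uminus_L_iff: "- w \<in> L \<longleftrightarrow> w \<in> L"
  using uminus_L[of w] uminus_L[of "-w"] by auto

lemma countable_L: "countable L"
proof -
  have "L = (\<lambda>(k,l). of_int k * \<omega>1 + of_int l * \<omega>2) ` (UNIV :: (int \<times> int) set)"
    by (auto simp: period_lattice_def)
  then show ?thesis by simp
qed

text \<open>
  The imaginary part of \<open>w * cnj \<omega>1\<close> is \<open>l\<close> times a nonzero constant, and that of \<open>w * cnj \<omega>2\<close> is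
  \<open>k\<close> times the opposite constant; both are bounded by a multiple of \<open>norm w\<close>.
\<close>
lemma period_coordinates_bound:
  "\<exists>c>0. \<forall>k l :: int. c * \<bar>of_int k\<bar> \<le> norm (of_int k * \<omega>1 + of_int l * \<omega>2) \<and>
                     c * \<bar>of_int l\<bar> \<le> norm (of_int k * \<omega>1 + of_int l * \<omega>2)"
proof -
  define D where "D = Im (\<omega>2 * cnj \<omega>1)"
  have w1: "\<omega>1 \<noteq> 0" and nr: "\<omega>2 / \<omega>1 \<notin> \<real>" using periods by (auto simp: fundamental_periods_def)
  have D: "D \<noteq> 0"
  proof
    assume "D = 0"
    have "Im (\<omega>2 / \<omega>1) = D / (norm \<omega>1)^2"
      by (simp add: Im_divide D_def cmod_power2 algebra_simps)
    with \<open>D = 0\<close> nr show False by (simp add: complex_is_Real_iff)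
  qed
  have w2: "\<omega>2 \<noteq> 0" using nr by auto
  define c where "c = \<bar>D\<bar> / (norm \<omega>1 + norm \<omega>2)"
  have s: "norm \<omega>1 + norm \<omega>2 > 0" using w1 by (simp add: add_pos_nonneg)
  have *: "\<bar>D\<bar> * \<bar>x\<bar> \<le> norm w * (norm \<omega>1 + norm \<omega>2) \<Longrightarrow> c * \<bar>x\<bar> \<le> norm w" for x :: real and w :: complex
    using s by (simp add: c_def field_simps)
  show ?thesis
  proof (intro exI[of _ c] conjI allI)
    show "c > 0" using D s by (simp add: c_def)
    fix k l :: int
    define w where "w = of_int k * \<omega>1 + of_int l * \<omega>2"
    have "Im (w * cnj \<omega>2) = - of_int k * D"
      by (simp add: w_def D_def algebra_simps)
    then have "\<bar>D\<bar> * \<bar>of_int k\<bar> \<le> norm w * norm \<omega>2"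
      by (metis abs_Im_le_cmod abs_minus_cancel abs_mult complex_mod_cnj minus_mult_left mult.commute norm_mult)
    also have "\<dots> \<le> norm w * (norm \<omega>1 + norm \<omega>2)" by (simp add: mult_left_mono)
    finally show "c * \<bar>of_int k\<bar> \<le> norm (of_int k * \<omega>1 + of_int l * \<omega>2)" using * w_def by simp
    have "Im (w * cnj \<omega>1) = of_int l * D"
      by (simp add: w_def D_def algebra_simps)
    then have "\<bar>D\<bar> * \<bar>of_int l\<bar> \<le> norm w * norm \<omega>1"
      by (metis abs_Im_le_cmod abs_mult complex_mod_cnj mult.commute norm_mult)
    also have "\<dots> \<le> norm w * (norm \<omega>1 + norm \<omega>2)" by (simp add: mult_left_mono)
    finally show "c * \<bar>of_int l\<bar> \<le> norm (of_int k * \<omega>1 + of_int l * \<omega>2)" using * w_def by simp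
  qed
qed

text \<open>
  With \<open>N\<close> the larger of \<open>\<bar>k\<bar>\<close> and \<open>\<bar>l\<bar>\<close>, one has \<open>N\<^sup>3 \<ge> ((1 + \<bar>k\<bar>) (1 + \<bar>l\<bar>)) powr (3/2) / 8\<close>
  away from the origin. This bounds the double series by a product of two convergent single series.
\<close>
lemma summable_inverse_cube: "(\<lambda>w. 1 / norm w ^ 3) summable_on L0"
proof -
  obtain c where c0: "c > 0" and c':
    "\<forall>k l :: int. c * \<bar>of_int k\<bar> \<le> norm (of_int k * \<omega>1 + of_int l * \<omega>2) \<and>
                c * \<bar>of_int l\<bar> \<le> norm (of_int k * \<omega>1 + of_int l * \<omega>2)"
    using period_coordinates_bound by blast
  have c: "c > 0" "c * \<bar>of_int k\<bar> \<le> norm (of_int k * \<omega>1 + of_int l * \<omega>2)"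
    "c * \<bar>of_int l\<bar> \<le> norm (of_int k * \<omega>1 + of_int l * \<omega>2)" for k l :: int
    using c0 c' by auto
  define h where "h = (\<lambda>(k::int,l::int). of_int k * \<omega>1 + of_int l * \<omega>2)"
  define p where "p = (\<lambda>k::int. (1 + \<bar>real_of_int k\<bar>) powr (-3/2))"
  have p: "p summable_on UNIV" unfolding p_def by (rule summable_on_int_powr)
  have p_nonneg: "p k \<ge> 0" for k by (simp add: p_def)
  have "(\<lambda>(k,l). p k * p l) summable_on UNIV \<times> UNIV"
  proof (rule summable_on_SigmaI)
    fix k :: int
    have "((\<lambda>l. p k * p l) has_sum (p k * infsum p UNIV)) UNIV"
      by (intro has_sum_cmult_right has_sum_infsum p)
    then show "((\<lambda>l. case (k, l) of (k, l) \<Rightarrow> p k * p l) has_sum (p k * infsum p UNIV)) UNIV"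
      by simp
  next
    show "(\<lambda>k. p k * infsum p UNIV) summable_on UNIV"
      by (intro summable_on_cmult_left p)
  qed (auto simp: p_nonneg)
  then have pp: "(\<lambda>(k,l). 8 / c^3 * (p k * p l)) summable_on UNIV"
    using summable_on_cmult_right[of "\<lambda>(k,l). p k * p l" UNIV "8/c^3"] by (simp add: case_prod_unfold)
  have inj: "inj h"
  proof (rule injI)
    fix x y assume e: "h x = h y"
    obtain k l k' l' where x: "x = (k,l)" "y = (k',l')" by (cases x, cases y)
    have z: "of_int (k-k') * \<omega>1 + of_int (l-l') * \<omega>2 = 0"
      using e by (simp add: x h_def algebra_simps)
    have "c * \<bar>of_int (k-k')\<bar> \<le> 0" "c * \<bar>of_int (l-l')\<bar> \<le> 0"
      using c(2)[of "k-k'" "l-l'"] c(3)[of "l-l'" "k-k'"] z by simp_all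
    then show "x = y" using c(1) by (auto simp: x mult_le_0_iff)
  qed
  have "(\<lambda>x. 1 / norm (h x) ^ 3) summable_on (UNIV - {(0,0)})"
  proof (rule summable_on_comparison_test[OF summable_on_subset_banach[OF pp]])
    fix x assume x: "x \<in> UNIV - {(0::int, 0::int)}"
    obtain k l where kl: "x = (k,l)" by (cases x)
    define N where "N = max \<bar>real_of_int k\<bar> \<bar>real_of_int l\<bar>"
    have N1: "N \<ge> 1" using x kl by (auto simp: N_def max_def)
    have cN: "c * N \<le> norm (h x)" using c(2)[of k l] c(3)[of l k] kl by (auto simp: N_def max_def h_def)
    have P: "(2*N) powr (-3/2) \<le> p k" "(2*N) powr (-3/2) \<le> p l"
      unfolding p_def using N1 by (auto simp: N_def intro!: powr_mono2')
    have "(2*N) powr (-3) = (2*N) powr (-3/2) * (2*N) powr (-3/2)"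
      by (simp flip: powr_add)
    also have "\<dots> \<le> p k * p l"
      by (rule mult_mono) (use P in \<open>auto simp: p_def\<close>)
    finally have "(2*N) powr (-3) \<le> p k * p l" .
    moreover have "(2*N) powr (-3) = 1 / (2*N) ^ 3"
      using N1 powr_realpow[of "2*N" 3] by (simp add: powr_minus_divide)
    ultimately have "1 / (8 * N^3) \<le> p k * p l"
      by (simp add: power_mult_distrib)
    then have "8 / c^3 * (1 / (8 * N^3)) \<le> 8 / c^3 * (p k * p l)"
      using c(1) by (intro mult_left_mono) auto
    moreover have "1 / norm (h x) ^ 3 \<le> 1 / (c*N)^3"
    proof (intro divide_left_mono power_mono)
      have "0 < c * N" using c(1) N1 by simp
      moreover from this cN have "0 < norm (h x)" by linarith
      ultimately show "0 < norm (h x) ^ 3 * (c * N) ^ 3" "0 \<le> c * N"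
        by (simp_all only: mult_pos_pos zero_less_power less_imp_le)
    qed (use cN in auto)
    ultimately show "1 / norm (h x) ^ 3 \<le> (case x of (k, l) \<Rightarrow> 8 / c ^ 3 * (p k * p l))"
      using c(1) by (simp add: kl power_mult_distrib)
  qed auto
  then have "(\<lambda>w. 1 / norm w ^ 3) summable_on h ` (UNIV - {(0,0)})"
    by (subst summable_on_reindex) (use inj in \<open>auto simp: o_def intro: inj_on_subset\<close>)
  moreover have "h ` (UNIV - {(0,0)}) = h ` UNIV - {h (0,0)}"
    using inj by (simp add: image_set_diff)
  moreover have "h ` UNIV = L" "h (0,0) = 0" by (auto simp: h_def period_lattice_def)
  ultimately show ?thesis by simp
qed

lemma finite_L_cball: "finite (L \<inter> cball 0 R)"
proof -
  obtain c where c0: "c > 0" and c':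
    "\<forall>k l :: int. c * \<bar>of_int k\<bar> \<le> norm (of_int k * \<omega>1 + of_int l * \<omega>2) \<and>
                c * \<bar>of_int l\<bar> \<le> norm (of_int k * \<omega>1 + of_int l * \<omega>2)"
    using period_coordinates_bound by blast
  have c: "c > 0" "c * \<bar>of_int k\<bar> \<le> norm (of_int k * \<omega>1 + of_int l * \<omega>2)"
    "c * \<bar>of_int l\<bar> \<le> norm (of_int k * \<omega>1 + of_int l * \<omega>2)" for k l :: int
    using c0 c' by auto
  define n where "n = \<lceil>R / c\<rceil>"
  have n: "\<bar>k\<bar> \<le> n" if "c * \<bar>of_int k\<bar> \<le> R" for k :: int
  proof -
    have "\<bar>of_int k\<bar> \<le> R / c" using that c(1) by (simp add: field_simps)
    then show ?thesis unfolding n_def by linarith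
  qed
  have "L \<inter> cball 0 R \<subseteq> (\<lambda>(k,l). of_int k * \<omega>1 + of_int l * \<omega>2) ` ({-n..n} \<times> {-n..n})"
  proof
    fix w assume "w \<in> L \<inter> cball 0 R"
    then obtain k l where w: "w = of_int k * \<omega>1 + of_int l * \<omega>2" "norm w \<le> R"
      by (auto simp: period_lattice_def)
    have "\<bar>k\<bar> \<le> n" "\<bar>l\<bar> \<le> n"
      using c(2)[of k l] c(3)[of l k] w by (auto intro!: n)
    then show "w \<in> (\<lambda>(k,l). of_int k * \<omega>1 + of_int l * \<omega>2) ` ({-n..n} \<times> {-n..n})"
      using w by (auto intro!: image_eqI[of _ _ "(k,l)"])
  qed
  then show ?thesis by (rule finite_subset) auto
qed

lemma closed_subset_L:
  assumes "A \<subseteq> L" shows "closed A"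
proof -
  have "\<not> z islimpt A" for z
  proof -
    have "A \<inter> ball z 1 \<subseteq> L \<inter> cball 0 (norm z + 1)"
    proof
      fix u assume "u \<in> A \<inter> ball z 1"
      then show "u \<in> L \<inter> cball 0 (norm z + 1)"
        using assms norm_triangle_sub[of u z] by (auto simp: dist_norm norm_minus_commute)
    qed
    then have "finite (A \<inter> ball z 1)" using finite_L_cball finite_subset by blast
    then show ?thesis using islimpt_eq_infinite_ball[of z A] zero_less_one by blast
  qed
  then show ?thesis by (simp add: closed_limpt)
qed

end

section \<open>Convergence of the Weierstrass functions\<close>

lemma prod_has_log_derivative:
  assumes "finite A" "\<And>w. w \<in> A \<Longrightarrow> (f w has_field_derivative l w * f w z) (at (z::complex))"
  shows "((\<lambda>z. \<Prod>w\<in>A. f w z) has_field_derivative (\<Sum>w\<in>A. l w) * (\<Prod>w\<in>A. f w z)) (at z)"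
  using assms
proof (induction A rule: finite_induct)
  case (insert x A)
  have "((\<lambda>z. f x z * (\<Prod>w\<in>A. f w z)) has_field_derivative
      l x * f x z * (\<Prod>w\<in>A. f w z) + (\<Sum>w\<in>A. l w) * (\<Prod>w\<in>A. f w z) * f x z) (at z)"
    by (rule DERIV_mult) (use insert in auto)
  then show ?case using insert by (simp add: algebra_simps)
qed auto

lemma zeta_term_eq:
  fixes z w :: complex
  assumes "w \<noteq> 0" "z \<noteq> w"
  shows "1 / (z - w) + 1 / w + z / w^2 = z^2 / (w^2 * (z - w))"
proof -
  have "z - w \<noteq> 0" using assms by simp
  then show ?thesis using assms(1) by (simp add: field_simps power2_eq_square)
qed

lemma log_derivative_eq:
  fixes z w :: complex
  assumes "w \<noteq> 0" "z \<noteq> w"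
  shows "- (1 / w) / (1 - z / w) = 1 / (z - w)"
proof -
  have "1 - z / w = - (z - w) / w" using assms by (simp add: field_simps)
  then show ?thesis using assms by (simp add: field_simps)
qed

lemma exponent_has_derivative:
  "((\<lambda>z. z / w + z^2 / (2 * w^2)) has_field_derivative 1 / w + z / w^2) (at (z::complex))"
proof -
  have "((\<lambda>z. z^2 / (2 * w^2)) has_field_derivative 2 * z / (2 * w^2)) (at z)"
    by (rule DERIV_cdivide) (auto intro!: derivative_eq_intros)
  from DERIV_add[OF DERIV_cdivide[OF DERIV_ident] this] show ?thesis by simp
qed

lemma linear_factor_has_derivative:
  "((\<lambda>z. 1 - z / w) has_field_derivative - (1 / w)) (at (z::complex))"
  using DERIV_diff[OF DERIV_const DERIV_cdivide[OF DERIV_ident], of 1 w z] by simp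

lemma zeta_term_has_derivative:
  "w \<noteq> 0 \<Longrightarrow> z \<noteq> (w::complex) \<Longrightarrow> ((\<lambda>z. 1 / (z - w) + 1 / w + z / w^2) has_field_derivative
     - (1 / (z - w)^2 - 1 / w^2)) (at z)"
  by (auto intro!: derivative_eq_intros simp: power2_eq_square)

context lattice begin

text \<open>
  On \<open>ball 0 R\<close> the finitely many lattice points in \<open>near R\<close>, together with \<open>0\<close>, account for all poles and zeros, while for \<open>w\<close> in
  \<open>far R\<close> the quotient \<open>z / w\<close> stays below \<open>1 / 2\<close>, so that principal logarithms are available.
\<close>
definition near :: "real \<Rightarrow> complex set" where "near R = {w \<in> L0. norm w \<le> 2 * R}"
definition far :: "real \<Rightarrow> complex set" where "far R = {w \<in> L0. norm w > 2 * R}"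

abbreviation log_term :: "complex \<Rightarrow> complex \<Rightarrow> complex" where
  "log_term w z \<equiv> Ln (1 - z / w) + z / w + z^2 / (2 * w^2)"
abbreviation zeta_term :: "complex \<Rightarrow> complex \<Rightarrow> complex" where
  "zeta_term w z \<equiv> 1 / (z - w) + 1 / w + z / w^2"
abbreviation p_term :: "complex \<Rightarrow> complex \<Rightarrow> complex" where
  "p_term w z \<equiv> 1 / (z - w)^2 - 1 / w^2"
abbreviation primary_factor :: "complex \<Rightarrow> complex \<Rightarrow> complex" where
  "primary_factor w z \<equiv> (1 - z / w) * exp (z / w + z^2 / (2 * w^2))"

lemma near_far: "L0 = near R \<union> far R" "near R \<inter> far R = {}"
  by (auto simp: near_def far_def)

lemma finite_near: "finite (near R)"
  by (rule finite_subset[OF _ finite_L_cball[of "2 * R"]]) (auto simp: near_def)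

lemma summable_far: "(\<lambda>w. C * (1 / norm w ^ 3)) summable_on far R"
  by (intro summable_on_cmult_right summable_on_subset_banach[OF summable_inverse_cube])
    (auto simp: far_def)

lemma far_norm:
  assumes "w \<in> far R" "z \<in> ball 0 R"
  shows "w \<noteq> 0" "norm (z / w) < 1 / 2" "norm w / 2 \<le> norm (z - w)" "z \<noteq> w"
proof -
  have *: "norm z < R" "2 * R < norm w" using assms by (auto simp: far_def)
  have R: "0 < R" using * norm_ge_zero[of z] by linarith
  show w: "w \<noteq> 0" using R * by auto
  show "norm (z / w) < 1 / 2" using * w by (simp add: norm_divide divide_simps)
  show "norm w / 2 \<le> norm (z - w)" using * norm_triangle_ineq2[of w z] by (simp add: norm_minus_commute)
  show "z \<noteq> w" using R * by auto
qed

lemma zeta_term_bound: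
  assumes "w \<in> far R" "z \<in> ball 0 R"
  shows "norm (zeta_term w z) \<le> 2 * R^2 * (1 / norm w ^ 3)"
proof -
  note f = far_norm[OF assms]
  have "zeta_term w z = z^2 / (w^2 * (z - w))"
    using f(1,4) by (rule zeta_term_eq)
  then have "norm (zeta_term w z) = norm z ^ 2 / (norm w ^ 2 * norm (z - w))"
    by (simp add: norm_divide norm_mult norm_power)
  also have "\<dots> \<le> R ^ 2 / (norm w ^ 2 * (norm w / 2))"
    using f assms by (intro frac_le power_mono mult_left_mono) auto
  also have "\<dots> = 2 * R^2 * (1 / norm w ^ 3)"
    using f(1) by (simp add: power2_eq_square power3_eq_cube)
  finally show ?thesis .
qed

lemma log_term_deriv:
  assumes "w \<in> far R" "z \<in> ball 0 R"
  shows "(log_term w has_field_derivative zeta_term w z) (at z)"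
proof -
  note f = far_norm[OF assms]
  have "Re (z / w) < 1" using f(2) complex_Re_le_cmod[of "z / w"] by linarith
  then have "1 - z / w \<notin> \<real>\<^sub>\<le>\<^sub>0" by (auto simp: complex_nonpos_Reals_iff)
  then have "((\<lambda>z. Ln (1 - z / w)) has_field_derivative inverse (1 - z / w) * - (1 / w)) (at z)"
    by (intro DERIV_chain'[OF linear_factor_has_derivative] has_field_derivative_Ln)
  also have "inverse (1 - z / w) * - (1 / w) = 1 / (z - w)"
    unfolding log_derivative_eq[OF f(1,4), symmetric] by (rule divide_inverse_commute[symmetric])
  finally show ?thesis
    using DERIV_add[OF _ exponent_has_derivative[of w z]] by (simp only: add.assoc)
qed

text \<open>
  The terms vanish at \<open>0\<close> and the bound for their derivatives is already known, so the mean value inequality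
  replaces an estimate of the logarithm.
\<close>
lemma log_term_bound:
  assumes w: "w \<in> far R" and z: "z \<in> ball 0 R"
  shows "norm (log_term w z) \<le> 2 * R^3 * (1 / norm w ^ 3)"
proof -
  have R: "0 < R" using z norm_ge_zero[of z] by (auto simp del: norm_ge_zero)
  have "norm (log_term w z - log_term w 0) \<le> 2 * R^2 * (1 / norm w ^ 3) * norm (z - 0)"
    by (rule field_differentiable_bound[of "ball 0 R" _ "zeta_term w"])
      (use log_term_deriv[OF w] zeta_term_bound[OF w] z R
        in \<open>auto intro: has_field_derivative_at_within\<close>)
  also have "\<dots> \<le> 2 * R^2 * (1 / norm w ^ 3) * R"
    by (rule mult_left_mono) (use z R in auto)
  finally show ?thesis by (simp add: power2_eq_square power3_eq_cube mult_ac)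
qed

lemma log_series:
  assumes z: "z \<in> ball 0 R"
  shows "(\<lambda>w. log_term w z) summable_on far R" and "(\<lambda>w. zeta_term w z) summable_on far R"
    and "((\<lambda>z. \<Sum>\<^sub>\<infinity>w\<in>far R. log_term w z) has_field_derivative
            (\<Sum>\<^sub>\<infinity>w\<in>far R. zeta_term w z)) (at z)"
  by (rule infsum_has_field_derivative[where S = "ball 0 R", OF _ _ summable_far open_ball z];
      blast intro: log_term_deriv log_term_bound)+

lemma zeta_series:
  assumes z: "z \<in> ball 0 R"
  shows "(\<lambda>w. p_term w z) summable_on far R"
    and "((\<lambda>z. \<Sum>\<^sub>\<infinity>w\<in>far R. zeta_term w z) has_field_derivative
            - (\<Sum>\<^sub>\<infinity>w\<in>far R. p_term w z)) (at z)"
proof -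
  have d: "(zeta_term w has_field_derivative - p_term w z) (at z)"
    if "w \<in> far R" "z \<in> ball 0 R" for w z
    using far_norm[OF that] by (intro zeta_term_has_derivative)
  have b: "norm (zeta_term w z) \<le> 2 * R^2 * (1 / norm w ^ 3)"
    if "w \<in> far R" "z \<in> ball 0 R" for w z
    by (rule zeta_term_bound[OF that])
  note * = infsum_has_field_derivative[where A = "far R" and S = "ball 0 R",
      OF d b summable_far open_ball z, simplified]
  show "(\<lambda>w. p_term w z) summable_on far R"
    using *(2) summable_on_uminus[of "\<lambda>w. p_term w z" "far R"] by simp
  show "((\<lambda>z. \<Sum>\<^sub>\<infinity>w\<in>far R. zeta_term w z) has_field_derivative
            - (\<Sum>\<^sub>\<infinity>w\<in>far R. p_term w z)) (at z)"
    using *(3) by (simp flip: infsum_uminus)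
qed

lemma zeta_split:
  assumes "z \<in> ball 0 R"
  shows "zet z = 1 / z + (\<Sum>w\<in>near R. zeta_term w z) + (\<Sum>\<^sub>\<infinity>w\<in>far R. zeta_term w z)"
  unfolding weierstrass_zeta_def near_far(1)[of R]
  using infsum_Un_disjoint[OF summable_on_finite[OF finite_near] log_series(2)[OF assms] near_far(2)]
    finite_near by (simp add: add.assoc)

lemma p_split:
  assumes "z \<in> ball 0 R"
  shows "wp z = 1 / z^2 + (\<Sum>w\<in>near R. p_term w z) + (\<Sum>\<^sub>\<infinity>w\<in>far R. p_term w z)"
  unfolding weierstrass_p_def near_far(1)[of R]
  using infsum_Un_disjoint[OF summable_on_finite[OF finite_near] zeta_series(1)[OF assms] near_far(2)]
    finite_near by (simp add: add.assoc)

text \<open>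
  The definition of \<open>\<sigma>\<close> uses unordered products. As soon as a finite set contains \<open>near R\<close>, its product
  is the fixed finite product over \<open>near R\<close> times the exponential of a partial sum of logarithms.
\<close>
lemma sigma_split:
  assumes z: "z \<in> ball 0 R"
  shows "sig z = z * ((\<Prod>w\<in>near R. primary_factor w z) * exp (\<Sum>\<^sub>\<infinity>w\<in>far R. log_term w z))"
proof -
  let ?l = "\<lambda>w. if w \<in> far R then log_term w z else 0"
  let ?S = "\<Sum>\<^sub>\<infinity>w\<in>far R. log_term w z"
  have "(?l has_sum ?S) L0"
    by (subst has_sum_cong_neutral[where T = "far R" and g = "\<lambda>w. log_term w z"])
      (use log_series(1)[OF z] in \<open>auto simp: near_far(1)[of R] has_sum_infsum\<close>)
  then have "((\<lambda>F. (\<Prod>w\<in>near R. primary_factor w z) * exp (\<Sum>w\<in>F. ?l w)) \<longlongrightarrow>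
      (\<Prod>w\<in>near R. primary_factor w z) * exp ?S) (finite_subsets_at_top L0)"
    unfolding has_sum_def by (intro tendsto_intros)
  moreover have "\<forall>\<^sub>F F in finite_subsets_at_top L0.
      (\<Prod>w\<in>near R. primary_factor w z) * exp (\<Sum>w\<in>F. ?l w) = (\<Prod>w\<in>F. primary_factor w z)"
    unfolding eventually_finite_subsets_at_top
  proof (intro exI[of _ "near R"] conjI allI impI finite_near)
    show "near R \<subseteq> L0" by (auto simp: near_def)
    fix F assume F: "finite F \<and> near R \<subseteq> F \<and> F \<subseteq> L0"
    have "exp (log_term w z) = primary_factor w z" if "w \<in> far R" for w
    proof -
      have "1 - z / w \<noteq> 0" using far_norm(1,4)[OF that z] by simp
      then show ?thesis by (simp only: exp_add add.assoc exp_Ln not_False_eq_True)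
    qed
    moreover have "F - near R \<subseteq> far R" using F near_far(1)[of R] by blast
    ultimately have "(\<Prod>w\<in>F - near R. primary_factor w z) = (\<Prod>w\<in>F - near R. exp (?l w))"
      by (intro prod.cong refl) (simp only: subsetD if_True)
    also have "\<dots> = exp (\<Sum>w\<in>F - near R. ?l w)"
      using F by (simp add: exp_sum)
    also have "(\<Sum>w\<in>F - near R. ?l w) = (\<Sum>w\<in>F. ?l w)"
      by (rule sum.mono_neutral_left) (use F near_far(2)[of R] in \<open>auto simp: disjoint_iff\<close>)
    finally show "(\<Prod>w\<in>near R. primary_factor w z) * exp (\<Sum>w\<in>F. ?l w) = (\<Prod>w\<in>F. primary_factor w z)"
      using prod.subset_diff[of "near R" F "\<lambda>w. primary_factor w z"] F by (simp only: mult.commute)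
  qed
  ultimately have "((\<lambda>F. \<Prod>w\<in>F. primary_factor w z) \<longlongrightarrow>
      (\<Prod>w\<in>near R. primary_factor w z) * exp ?S) (finite_subsets_at_top L0)"
    using Lim_transform_eventually by blast
  then show ?thesis
    unfolding weierstrass_sigma_def by (simp add: tendsto_Lim)
qed

lemma sigma_has_derivative:
  assumes z: "z \<notin> L"
  shows "(sig has_field_derivative zet z * sig z) (at z)"
proof -
  define R where "R = norm z + 1"
  have zR: "z \<in> ball 0 R" by (simp add: R_def)
  have z0: "z \<noteq> 0" using z zero_in_L by auto
  have d: "((\<lambda>z. primary_factor w z) has_field_derivative zeta_term w z * primary_factor w z) (at z)"
    if "w \<in> near R" for w
  proof -
    have w: "w \<noteq> 0" "z \<noteq> w" using that z by (auto simp: near_def)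
    let ?e = "exp (z / w + z^2 / (2 * w^2))"
    have "(primary_factor w has_field_derivative
        - (1 / w) * ?e + ?e * (1 / w + z / w^2) * (1 - z / w)) (at z)"
      by (intro DERIV_mult linear_factor_has_derivative
          DERIV_chain'[OF exponent_has_derivative DERIV_exp])
    also have "- (1 / w) = 1 / (z - w) * (1 - z / w)"
      using w by (simp add: field_simps)
    also have "1 / (z - w) * (1 - z / w) * ?e + ?e * (1 / w + z / w^2) * (1 - z / w)
       = zeta_term w z * primary_factor w z"
    proof -
      have "A * B * E + E * (C + D) * B = (A + C + D) * (B * E)" for A B C D E :: complex
        by (simp add: algebra_simps)
      then show ?thesis .
    qed
    finally show ?thesis .
  qed
  let ?P = "\<lambda>z. \<Prod>w\<in>near R. primary_factor w z"
  let ?E = "\<lambda>z. exp (\<Sum>\<^sub>\<infinity>w\<in>far R. log_term w z)"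
  let ?N = "\<Sum>w\<in>near R. zeta_term w z"
  let ?Z = "\<Sum>\<^sub>\<infinity>w\<in>far R. zeta_term w z"
  have dP: "(?P has_field_derivative ?N * ?P z) (at z)"
    by (rule prod_has_log_derivative[OF finite_near d])
  have dE: "(?E has_field_derivative ?E z * ?Z) (at z)"
    by (rule DERIV_chain'[OF log_series(3)[OF zR] DERIV_exp])
  have "((\<lambda>z. z * (?P z * ?E z)) has_field_derivative
      1 * (?P z * ?E z) + (?N * ?P z * ?E z + ?E z * ?Z * ?P z) * z) (at z)"
    by (intro DERIV_mult DERIV_ident dP dE)
  also have "1 * (?P z * ?E z) + (?N * ?P z * ?E z + ?E z * ?Z * ?P z) * z
    = (1 / z + ?N + ?Z) * (z * (?P z * ?E z))"
    using z0 by (simp add: algebra_simps)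
  also have "\<dots> = zet z * sig z"
    by (simp only: zeta_split[OF zR] sigma_split[OF zR])
  finally show ?thesis
    by (rule has_field_derivative_transform_within_open[OF _ open_ball zR]) (simp only: sigma_split)
qed

lemma sigma_nonzero:
  assumes z: "z \<notin> L"
  shows "sig z \<noteq> 0"
proof -
  have zR: "z \<in> ball 0 (norm z + 1)" by simp
  have "z \<noteq> 0" using z zero_in_L by auto
  moreover have "1 - z / w \<noteq> 0" if "w \<in> near (norm z + 1)" for w
    using that z by (auto simp: near_def)
  ultimately show ?thesis
    unfolding sigma_split[OF zR] by (auto simp: finite_near)
qed

lemma zeta_has_derivative:
  assumes z: "z \<notin> L"
  shows "(zet has_field_derivative - wp z) (at z)"
proof -
  define R where "R = norm z + 1"
  have zR: "z \<in> ball 0 R" by (simp add: R_def)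
  have z0: "z \<noteq> 0" using z zero_in_L by auto
  have d: "(zeta_term w has_field_derivative - p_term w z) (at z)" if "w \<in> near R" for w
    by (rule zeta_term_has_derivative) (use that z in \<open>auto simp: near_def\<close>)
  have "((\<lambda>z. 1 / z + (\<Sum>w\<in>near R. zeta_term w z) + (\<Sum>\<^sub>\<infinity>w\<in>far R. zeta_term w z))
    has_field_derivative - (1 / z^2) + (\<Sum>w\<in>near R. - p_term w z) + - (\<Sum>\<^sub>\<infinity>w\<in>far R. p_term w z)) (at z)"
    by (intro DERIV_add DERIV_sum d zeta_series(2)[OF zR])
      (use z0 in \<open>auto intro!: derivative_eq_intros simp: power2_eq_square\<close>)
  also have "- (1 / z^2) + (\<Sum>w\<in>near R. - p_term w z) + - (\<Sum>\<^sub>\<infinity>w\<in>far R. p_term w z) = - wp z"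
    unfolding p_split[OF zR] by (simp only: sum_negf minus_add_distrib)
  finally show ?thesis
    by (rule has_field_derivative_transform_within_open[OF _ open_ball zR]) (simp only: zeta_split)
qed

lemma wp_holomorphic: "wp holomorphic_on - L"
proof -
  have "open (- L)" using closed_subset_L[of L] by auto
  moreover have "zet holomorphic_on - L"
    using zeta_has_derivative \<open>open (- L)\<close> by (auto simp: holomorphic_on_open)
  ultimately have "(\<lambda>z. - deriv zet z) holomorphic_on - L"
    by (intro holomorphic_on_minus holomorphic_deriv)
  then show ?thesis
    by (rule holomorphic_transform) (use zeta_has_derivative DERIV_imp_deriv in fastforce)
qed

lemma zeta_odd: "zet (- z) = - zet z"
proof -
  have reflect: "zeta_term (- w) (- z) = - zeta_term w z" for w
    using minus_divide_right[of 1 "z - w"] by simp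
  have "(\<Sum>\<^sub>\<infinity>w\<in>L0. zeta_term w (- z)) = (\<Sum>\<^sub>\<infinity>w\<in>L0. - zeta_term w z)"
    by (rule infsum_reindex_bij_witness[of _ uminus uminus])
      (use reflect[of "- _"] in \<open>auto simp: uminus_L_iff\<close>)
  also have "\<dots> = - (\<Sum>\<^sub>\<infinity>w\<in>L0. zeta_term w z)" by (rule infsum_uminus)
  finally show ?thesis by (simp add: weierstrass_zeta_def)
qed

lemma wp_even: "wp (- z) = wp z"
proof -
  have reflect: "p_term (- w) (- z) = p_term w z" for w
    by (simp add: power2_commute)
  have "(\<Sum>\<^sub>\<infinity>w\<in>L0. p_term w (- z)) = (\<Sum>\<^sub>\<infinity>w\<in>L0. p_term w z)"
    by (rule infsum_reindex_bij_witness[of _ uminus uminus])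
      (use reflect[of "- _"] in \<open>auto simp: uminus_L_iff\<close>)
  then show ?thesis by (simp add: weierstrass_p_def)
qed

text \<open>
  For a radius smaller than all nonzero periods no other pole interferes, and \<open>\<zeta>\<close> and \<open>\<wp>\<close> share a
  single holomorphic correction \<open>e\<close>.
\<close>
lemma zeta_wp_at_0:
  obtains r e where "r > 0" "L \<inter> ball 0 r = {0}" "e holomorphic_on ball 0 r" "e 0 = 0"
    "\<And>z. z \<in> ball 0 r \<Longrightarrow> z \<noteq> 0 \<Longrightarrow> zet z = 1 / z + e z"
    "\<And>z. z \<in> ball 0 r \<Longrightarrow> z \<noteq> 0 \<Longrightarrow> wp z = 1 / z^2 - deriv e z"
proof -
  have "closed L0" by (rule closed_subset_L) auto
  then obtain r where r: "r > 0" "ball 0 (2 * r) \<subseteq> - L0"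
    by (metis ComplI Diff_iff insertI1 open_Compl openE field_sum_of_halves half_gt_zero mult_2)
  show ?thesis
  proof (rule that[of "r/2" "\<lambda>z. \<Sum>\<^sub>\<infinity>w\<in>far (r/2). zeta_term w z"])
    let ?e = "\<lambda>z. \<Sum>\<^sub>\<infinity>w\<in>far (r/2). zeta_term w z"
    show "r / 2 > 0" using r by simp
    have away: "w = 0" if "w \<in> L" "norm w < 2 * r" for w
      using r(2) that by (auto simp: subset_iff)
    show "L \<inter> ball 0 (r / 2) = {0}" using r(1) zero_in_L away by auto
    have near: "near (r/2) = {}" using r(1) away by (fastforce simp: near_def)
    show "?e holomorphic_on ball 0 (r/2)"
      unfolding holomorphic_on_open[OF open_ball] using zeta_series(2) by blast
    show "?e 0 = 0" by (rule infsum_0) auto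
    fix z :: complex assume z: "z \<in> ball 0 (r/2)" "z \<noteq> 0"
    show "zet z = 1 / z + ?e z" using zeta_split[OF z(1)] near by simp
    show "wp z = 1 / z^2 - deriv ?e z" using p_split[OF z(1)] near
      DERIV_imp_deriv[OF zeta_series(2)[OF z(1)]] by simp
  qed
qed

end

section \<open>Analytic properties of the Weierstrass functions\<close>

lemma holomorphic_isCont_deriv:
  "f holomorphic_on S \<Longrightarrow> open S \<Longrightarrow> z \<in> S \<Longrightarrow> isCont (deriv f) z"
  by (rule DERIV_isCont[OF holomorphic_derivI[OF holomorphic_deriv]])

lemma punctured_ball_nonempty: "r > 0 \<Longrightarrow> ball 0 r - {0::complex} \<noteq> {}"
proof -
  assume "r > 0"
  then have "complex_of_real (r / 2) \<in> ball 0 r - {0}" by simp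
  then show ?thesis by blast
qed

context lattice begin

lemma diff_L: "u \<in> L \<Longrightarrow> v \<in> L \<Longrightarrow> u - v \<in> L"
  unfolding period_lattice_def
  by clarify (rule_tac x = "k - ka" in exI, rule_tac x = "l - la" in exI, simp add: algebra_simps)

lemma closed_translate_L: "A \<subseteq> L \<Longrightarrow> closed ((+) c ` A)"
  by (intro closed_translation closed_subset_L)

lemma open_compl_L: "open (- L)"
  using closed_subset_L[of L] by auto

lemma wp_has_derivative: "z \<notin> L \<Longrightarrow> (wp has_field_derivative deriv wp z) (at z)"
  by (rule holomorphic_derivI[OF wp_holomorphic open_compl_L]) auto

lemma wp_deriv_holomorphic: "deriv wp holomorphic_on - L"
  by (rule holomorphic_deriv[OF wp_holomorphic open_compl_L])

lemma wp_deriv_odd: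
  assumes z: "z \<notin> L" shows "deriv wp (- z) = - deriv wp z"
proof -
  have "((\<lambda>z. wp (- z)) has_field_derivative deriv wp (- z) * - 1) (at z)"
    by (rule DERIV_chain2[OF wp_has_derivative])
      (use z in \<open>auto intro!: derivative_eq_intros simp: uminus_L_iff\<close>)
  then have "(wp has_field_derivative - deriv wp (- z)) (at z)"
    by (simp add: wp_even)
  from DERIV_unique[OF this wp_has_derivative[OF z]] show ?thesis
    by (metis minus_minus)
qed

text \<open>
  The term of the series that belongs to \<open>w\<close> produces the pole, and all others are continuous there.
  At \<open>w = 0\<close> the pole is the leading term of \<open>\<wp>\<close> instead.
\<close>
lemma wp_pole:
  assumes w: "w \<in> L"
  shows "((\<lambda>z. (z - w)^2 * wp z) \<longlongrightarrow> 1) (at w)"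
proof (cases "w = 0")
  case True
  obtain r e where r: "r > 0" and e: "e holomorphic_on ball 0 r"
    and wp: "\<And>z. z \<in> ball 0 r \<Longrightarrow> z \<noteq> 0 \<Longrightarrow> wp z = 1 / z^2 - deriv e z"
    using zeta_wp_at_0 by metis
  have "isCont (deriv e) 0"
    by (rule holomorphic_isCont_deriv[OF e open_ball]) (use r in simp)
  then have "((\<lambda>z. 1 - z^2 * deriv e z) \<longlongrightarrow> 1 - 0^2 * deriv e 0) (at 0)"
    unfolding isCont_def by (intro tendsto_intros)
  moreover have "\<forall>\<^sub>F z in at 0. 1 - z^2 * deriv e z = (z - 0)^2 * wp z"
    unfolding eventually_at
    by (rule exI[of _ r]) (use r wp in \<open>simp add: dist_norm right_diff_distrib\<close>)
  ultimately show ?thesis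
    unfolding True using Lim_transform_eventually[of _ "1 - 0^2 * deriv e 0" "at 0"] by simp
next
  case False
  define R where "R = norm w + 1"
  have wR: "w \<in> ball 0 R" by (simp add: R_def)
  have wnear: "w \<in> near R" using w False by (simp add: near_def R_def)
  let ?Z = "\<lambda>z. \<Sum>\<^sub>\<infinity>w\<in>far R. zeta_term w z"
  have Z: "?Z holomorphic_on ball 0 R"
    unfolding holomorphic_on_open[OF open_ball] using zeta_series(2) by blast
  have far: "(\<Sum>\<^sub>\<infinity>w\<in>far R. p_term w z) = - deriv ?Z z" if "z \<in> ball 0 R" for z
    using DERIV_imp_deriv[OF zeta_series(2)[OF that]] by simp
  have "isCont (deriv ?Z) w"
    by (rule holomorphic_isCont_deriv[OF Z open_ball wR])
  then have Zlim: "(deriv ?Z \<longlongrightarrow> deriv ?Z w) (at w)" by (simp add: isCont_def)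
  let ?T = "\<lambda>z. 1 / z^2 + (\<Sum>u\<in>near R - {w}. p_term u z) - 1 / w^2 - deriv ?Z z"
  have "((\<lambda>z. 1 + (z - w)^2 * ?T z) \<longlongrightarrow> 1 + (w - w)^2 * ?T w) (at w)"
    by (intro tendsto_intros Zlim) (use False in auto)
  moreover have "\<forall>\<^sub>F z in at w. 1 + (z - w)^2 * ?T z = (z - w)^2 * wp z"
    unfolding eventually_at
  proof (intro exI[of _ 1] conjI ballI impI)
    fix z assume z: "z \<noteq> w \<and> dist z w < 1"
    have zR: "z \<in> ball 0 R" using z norm_triangle_sub[of z w] by (simp add: R_def dist_norm)
    have "wp z = 1 / (z - w)^2 + ?T z"
      unfolding p_split[OF zR] far[OF zR]
      using sum.remove[OF finite_near wnear, of "\<lambda>u. p_term u z"] by simp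
    then show "1 + (z - w)^2 * ?T z = (z - w)^2 * wp z"
      using z by (simp add: distrib_left)
  qed simp
  ultimately show ?thesis
    using Lim_transform_eventually by fastforce
qed

end

section \<open>The addition theorem for a zero of the Weierstrass function\<close>

locale equianharmonic = lattice +
  fixes \<alpha> :: complex
  assumes ode: "\<And>z. z \<notin> L \<Longrightarrow> (deriv wp z)^2 = 4 * (wp z)^3 + 16"
    and alpha: "\<alpha> \<notin> L" "wp \<alpha> = 0" "deriv wp \<alpha> = 4"
begin

text \<open>
  Differentiating the first-order equation gives \<open>\<wp>' (\<wp>'' - 6 \<wp>\<^sup>2) = 0\<close>. The factor \<open>\<wp>'\<close> is nonzero near
  \<open>\<alpha>\<close>, so the other factor vanishes near \<open>\<alpha>\<close> and hence on the connected complement of the lattice.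
\<close>
lemma wp_second_derivative:
  assumes z: "z \<notin> L"
  shows "(deriv wp has_field_derivative 6 * (wp z)^2) (at z)"
proof -
  have d2: "(deriv wp has_field_derivative deriv (deriv wp) z) (at z)" if "z \<notin> L" for z
    by (rule holomorphic_derivI[OF wp_deriv_holomorphic open_compl_L]) (use that in auto)
  have prod: "deriv wp z * (deriv (deriv wp) z - 6 * (wp z)^2) = 0" if z: "z \<notin> L" for z
  proof -
    have 1: "((\<lambda>z. (deriv wp z)^2) has_field_derivative 2 * deriv wp z * deriv (deriv wp) z) (at z)"
      using DERIV_power[OF d2[OF z], of 2] by (simp add: mult_ac)
    have "((\<lambda>z. 4 * (wp z)^3 + 16) has_field_derivative 12 * (wp z)^2 * deriv wp z) (at z)"
      by (auto intro!: derivative_eq_intros wp_has_derivative[OF z])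
    then have 2: "((\<lambda>z. (deriv wp z)^2) has_field_derivative 12 * (wp z)^2 * deriv wp z) (at z)"
      by (rule has_field_derivative_transform_within_open[OF _ open_compl_L]) (use z ode in auto)
    show ?thesis using DERIV_unique[OF 1 2] by (simp add: algebra_simps)
  qed
  define U where "U = {z \<in> - L. deriv wp z \<in> - {0}}"
  have "open U"
    using continuous_open_preimage[OF holomorphic_on_imp_continuous_on[OF wp_deriv_holomorphic]
        open_compl_L open_delete[OF open_UNIV, of 0]]
    by (simp add: U_def vimage_def Int_def Compl_eq_Diff_UNIV)
  have "deriv (deriv wp) z = 6 * (wp z)^2"
  proof (rule analytic_continuation_open[of U "- L" "deriv (deriv wp)" "\<lambda>z. 6 * (wp z)^2"])
    show "U \<noteq> {}" using alpha by (auto simp: U_def)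
    show "connected (- L)"
      using path_connected_complement_countable[OF _ countable_L] path_connected_imp_connected by simp
    show "deriv (deriv wp) u = 6 * (wp u)^2" if "u \<in> U" for u
      using that prod[of u] by (auto simp: U_def)
  qed (use z \<open>open U\<close> open_compl_L wp_holomorphic wp_deriv_holomorphic in
        \<open>auto simp: U_def intro!: holomorphic_intros\<close>)
  then show ?thesis using d2[OF z] by simp
qed

text \<open>
  By the addition theorem this is \<open>\<zeta>(z - \<alpha>) - \<zeta>(z) + \<zeta>(\<alpha>)\<close>, the logarithmic derivative of
  \<open>\<sigma>(z - \<alpha>) exp(\<zeta>(\<alpha>) z) / \<sigma>(z)\<close>; see lemma \<open>zeta_shift\<close>.
\<close>
definition \<phi> :: "complex \<Rightarrow> complex" where "\<phi> z = (deriv wp z + 4) / (2 * wp z)"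

lemma phi_has_derivative:
  assumes z: "z \<notin> L" "wp z \<noteq> 0"
  shows "(\<phi> has_field_derivative 2 * wp z - (\<phi> z)^2) (at z)"
proof -
  let ?D = "(6 * (wp z)^2 * (2 * wp z) - (deriv wp z + 4) * (2 * deriv wp z)) / (2 * wp z * (2 * wp z))"
  have n: "((\<lambda>z. deriv wp z + 4) has_field_derivative 6 * (wp z)^2) (at z)"
    using DERIV_add[OF wp_second_derivative[OF z(1)] DERIV_const[of 4]] by simp
  have d: "((\<lambda>z. 2 * wp z) has_field_derivative 2 * deriv wp z) (at z)"
    by (rule DERIV_cmult[OF wp_has_derivative[OF z(1)]])
  have "(\<phi> has_field_derivative ?D) (at z)"
    unfolding \<phi>_def[abs_def] by (rule DERIV_divide[OF n d]) (use z in simp)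
  moreover have "?D = 2 * wp z - (\<phi> z)^2"
  proof -
    have "6 * (wp z)^2 * (2 * wp z) - (deriv wp z + 4) * (2 * deriv wp z) =
        2 * wp z * (2 * wp z * (2 * wp z)) - (deriv wp z + 4)^2"
      using ode[OF z(1)] by algebra
    then have "?D = (2 * wp z * (2 * wp z * (2 * wp z)) - (deriv wp z + 4)^2) / (2 * wp z * (2 * wp z))"
      by simp
    also have "\<dots> = 2 * wp z - (\<phi> z)^2"
      using z(2) by (simp add: \<phi>_def diff_divide_distrib power_divide power2_eq_square)
    finally show ?thesis .
  qed
  ultimately show ?thesis by simp
qed

lemma phi_relation:
  assumes z: "z \<notin> L" "wp z \<noteq> 0"
  shows "(\<phi> z)^2 - wp z = (2 * deriv wp z + 8) / (wp z)^2"
    and "deriv wp z = 2 * wp z * \<phi> z - 4"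
proof -
  show *: "deriv wp z = 2 * wp z * \<phi> z - 4"
    using z(2) by (simp add: \<phi>_def)
  have "(wp z)^2 * ((\<phi> z)^2 - wp z) = 2 * deriv wp z + 8"
  proof -
    have "4 * ((wp z)^2 * ((\<phi> z)^2 - wp z)) = 4 * (2 * deriv wp z + 8)"
      using ode[OF z(1)] * by algebra
    then show ?thesis by (simp only: mult_cancel_left) simp
  qed
  then show "(\<phi> z)^2 - wp z = (2 * deriv wp z + 8) / (wp z)^2"
    using z(2) by (simp add: field_simps)
qed

definition regular_domain :: "complex set" where "regular_domain = - (L \<union> (+) \<alpha> ` L)"

lemma regular_domain_iff: "z \<in> regular_domain \<longleftrightarrow> z \<notin> L \<and> z - \<alpha> \<notin> L"
  unfolding regular_domain_def by (auto simp: image_iff)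

lemma open_regular_domain: "open regular_domain"
  unfolding regular_domain_def using closed_subset_L[of L] closed_translate_L[of L \<alpha>] by (intro open_Compl closed_Un) auto

lemma connected_regular_domain: "connected regular_domain"
  unfolding regular_domain_def by (intro path_connected_imp_connected path_connected_complement_countable)
    (use countable_L in auto)

text \<open>
  The quotients are written over a power of \<open>z\<close> so that \<open>z\<close> cancels visibly in the rational
  expressions in \<open>\<wp>\<close> and \<open>\<wp>'\<close> whose singularity at \<open>0\<close> has to be removed. The radius also keeps
  \<open>z - \<alpha>\<close> off the lattice.
\<close>
lemma laurent_data_at_0:
  obtains r e p where "r > 0" "e holomorphic_on ball 0 r" "p holomorphic_on ball 0 r" "e 0 = 0"
    "\<And>z. z \<in> ball 0 r \<Longrightarrow> (e has_field_derivative - p z) (at z)"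
    "\<And>z. z \<in> ball 0 r \<Longrightarrow> 1 + z^2 * p z \<noteq> 0"
    "\<And>z. z \<in> ball 0 r \<Longrightarrow> z - \<alpha> \<notin> L"
    "\<And>z. z \<in> ball 0 r - {0} \<Longrightarrow> z \<notin> L"
    "\<And>z. z \<in> ball 0 r - {0} \<Longrightarrow> wp z = (1 + z^2 * p z) / z^2"
    "\<And>z. z \<in> ball 0 r - {0} \<Longrightarrow> zet z = 1 / z + e z"
    "\<And>z. z \<in> ball 0 r - {0} \<Longrightarrow> deriv wp z = (- 2 + z^3 * deriv p z) / z^3"
proof -
  obtain r e where r: "r > 0" "L \<inter> ball 0 r = {0}" and e: "e holomorphic_on ball 0 r" "e 0 = 0"
    and zet: "\<And>z. z \<in> ball 0 r \<Longrightarrow> z \<noteq> 0 \<Longrightarrow> zet z = 1 / z + e z"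
    and wp: "\<And>z. z \<in> ball 0 r \<Longrightarrow> z \<noteq> 0 \<Longrightarrow> wp z = 1 / z^2 - deriv e z"
    using zeta_wp_at_0 by metis
  define p where "p = (\<lambda>z. - deriv e z)"
  have p: "p holomorphic_on ball 0 r"
    unfolding p_def by (intro holomorphic_on_minus holomorphic_deriv e open_ball)
  let ?q = "\<lambda>z. 1 + z^2 * p z"
  have "continuous_on (ball 0 r) ?q"
    by (intro continuous_intros holomorphic_on_imp_continuous_on[OF p])
  then have "open (?q -` (- {0}) \<inter> ball 0 r)"
    by (subst Int_commute) (rule continuous_open_preimage, auto)
  moreover have "open ((\<lambda>z. z - \<alpha>) -` (- L))"
    by (intro continuous_open_vimage open_compl_L) (auto intro!: continuous_intros)
  ultimately have "open (?q -` (- {0}) \<inter> ball 0 r \<inter> (\<lambda>z. z - \<alpha>) -` (- L))" by blast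
  moreover have "0 \<in> ?q -` (- {0}) \<inter> ball 0 r \<inter> (\<lambda>z. z - \<alpha>) -` (- L)"
    using r alpha uminus_L_iff by auto
  ultimately obtain s where s: "s > 0" "ball 0 s \<subseteq> ?q -` (- {0}) \<inter> ball 0 r \<inter> (\<lambda>z. z - \<alpha>) -` (- L)"
    using openE by blast
  have sr: "ball 0 s \<subseteq> (ball 0 r :: complex set)" using s by blast
  show ?thesis
  proof (rule that[of s e p])
    show "s > 0" "e 0 = 0" by fact+
    show "e holomorphic_on ball 0 s" "p holomorphic_on ball 0 s"
      using e(1) p sr by (auto intro: holomorphic_on_subset)
    show "(e has_field_derivative - p z) (at z)" if "z \<in> ball 0 s" for z
      using holomorphic_derivI[OF e(1) open_ball, of z] that sr by (auto simp: p_def)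
    show "1 + z^2 * p z \<noteq> 0" "z - \<alpha> \<notin> L" if "z \<in> ball 0 s" for z
      using that s(2) by blast+
    show "z \<notin> L" if "z \<in> ball 0 s - {0}" for z
      using that sr r(2) by blast
    have *: "wp z = 1 / z^2 + p z" if "z \<in> ball 0 s - {0}" for z
      using wp[of z] that sr by (auto simp: p_def)
    show "wp z = (1 + z^2 * p z) / z^2" if "z \<in> ball 0 s - {0}" for z
      using *[OF that] that by (simp add: add_divide_distrib)
    show "zet z = 1 / z + e z" if "z \<in> ball 0 s - {0}" for z
      using zet[of z] that sr by blast
    show "deriv wp z = (- 2 + z^3 * deriv p z) / z^3" if z: "z \<in> ball 0 s - {0}" for z
    proof -
      have "(p has_field_derivative deriv p z) (at z)"
        using holomorphic_derivI[OF p open_ball, of z] z sr by blast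
      moreover have "((\<lambda>z. 1 / z^2) has_field_derivative - 2 / z^3) (at z)"
        using z by (auto intro!: derivative_eq_intros simp: power2_eq_square power3_eq_cube)
      ultimately have "((\<lambda>z. 1 / z^2 + p z) has_field_derivative - 2 / z^3 + deriv p z) (at z)"
        by (rule DERIV_add[rotated])
      then have "(wp has_field_derivative - 2 / z^3 + deriv p z) (at z)"
        by (rule has_field_derivative_transform_within_open[of _ _ _ "ball 0 s - {0}"]) (use z * in auto)
      from DERIV_imp_deriv[OF this] show ?thesis using z by (simp add: diff_divide_distrib)
    qed
  qed
qed

text \<open>
  The addition theorem for \<open>\<wp>\<close>, cleared of denominators. The function \<open>\<phi>\<^sup>2 - \<wp> = (2 \<wp>' + 8) / \<wp>\<^sup>2\<close>
  has a removable singularity at \<open>0\<close>. By the Riccati equation for \<open>\<phi>\<close> it solves \<open>y'' = 6 y\<^sup>2\<close>, just as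
  \<open>\<wp>(z - \<alpha>)\<close> does, and \<open>\<wp>\<close> even with \<open>\<wp>(\<alpha>) = 0\<close>, \<open>\<wp>'(\<alpha>) = 4\<close> gives both the same initial data at \<open>0\<close>.
\<close>
lemma wp_shift:
  assumes z: "z \<in> regular_domain"
  shows "2 * deriv wp z + 8 = (wp z)^2 * wp (z - \<alpha>)"
proof -
  obtain r e p where r: "r > 0" and "e holomorphic_on ball 0 r" and p: "p holomorphic_on ball 0 r"
    and "e 0 = 0"
    and "\<And>z. z \<in> ball 0 r \<Longrightarrow> (e has_field_derivative - p z) (at z)"
    and nz: "\<And>z. z \<in> ball 0 r \<Longrightarrow> 1 + z^2 * p z \<noteq> 0"
    and al: "\<And>z. z \<in> ball 0 r \<Longrightarrow> z - \<alpha> \<notin> L"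
    and L: "\<And>z. z \<in> ball 0 r - {0} \<Longrightarrow> z \<notin> L"
    and wp: "\<And>z. z \<in> ball 0 r - {0} \<Longrightarrow> wp z = (1 + z^2 * p z) / z^2"
    and "\<And>z. z \<in> ball 0 r - {0} \<Longrightarrow> zet z = 1 / z + e z"
    and wp': "\<And>z. z \<in> ball 0 r - {0} \<Longrightarrow> deriv wp z = (- 2 + z^3 * deriv p z) / z^3"
    by (rule laurent_data_at_0) (rule that; assumption)
  let ?S = "ball 0 r - {0} :: complex set"
  have openS: "open ?S" by auto
  have wpnz: "wp z \<noteq> 0" if "z \<in> ?S" for z
    using nz[of z] wp[OF that] that by auto
  \<comment> \<open>\<open>H = z * K\<close> is the holomorphic extension of \<open>\<phi>\<^sup>2 - \<wp>\<close> to \<open>0\<close>.\<close>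
  define K where "K = (\<lambda>z. (- 4 + 2 * z^3 * deriv p z + 8 * z^3) / (1 + z^2 * p z)^2)"
  define H where "H = (\<lambda>z. z * K z)"
  have K: "K holomorphic_on ball 0 r"
    unfolding K_def using p nz by (auto intro!: holomorphic_intros)
  then have H: "H holomorphic_on ball 0 r"
    unfolding H_def by (intro holomorphic_intros)
  have Hphi: "H z = (\<phi> z)^2 - wp z" if z: "z \<in> ?S" for z
  proof -
    define b where "b = 1 + z^2 * p z"
    have b: "b \<noteq> 0" "z \<noteq> 0" using nz z by (auto simp: b_def)
    have "(2 * deriv wp z + 8) / (wp z)^2 = (2 * ((- 2 + z^3 * deriv p z) / z^3) + 8) / (b / z^2)^2"
      using wp[OF z] wp'[OF z] by (simp add: b_def)
    also have "\<dots> = z * ((- 4 + 2 * z^3 * deriv p z + 8 * z^3) / b^2)"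
      using b by (simp add: field_simps power2_eq_square power3_eq_cube)
    also have "\<dots> = H z" by (simp add: H_def K_def b_def)
    finally show ?thesis using phi_relation(1)[OF L[OF z] wpnz[OF z]] by simp
  qed
  let ?h1 = "\<lambda>z. deriv wp z + 8 - 2 * (\<phi> z)^3"
  have dphi: "(\<phi> has_field_derivative 2 * wp z - (\<phi> z)^2) (at z)" if "z \<in> ?S" for z
    by (rule phi_has_derivative[OF L[OF that] wpnz[OF that]])
  have H1: "deriv H z = ?h1 z" if z: "z \<in> ?S" for z
  proof (rule DERIV_imp_deriv, rule has_field_derivative_transform_within_open[OF _ openS z])
    have "((\<lambda>z. (\<phi> z)^2 - wp z) has_field_derivative
        2 * \<phi> z * (2 * wp z - (\<phi> z)^2) - deriv wp z) (at z)"
      using DERIV_diff[OF DERIV_power[OF dphi[OF z], of 2] wp_has_derivative[OF L[OF z]]]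
      by (simp add: mult_ac)
    also have "2 * \<phi> z * (2 * wp z - (\<phi> z)^2) - deriv wp z = ?h1 z"
      using phi_relation(2)[OF L[OF z] wpnz[OF z]] by algebra
    finally show "((\<lambda>z. (\<phi> z)^2 - wp z) has_field_derivative ?h1 z) (at z)" .
  qed (use Hphi in auto)
  have H2: "deriv (deriv H) z = 6 * (H z)^2" if z: "z \<in> ?S" for z
  proof (rule DERIV_imp_deriv, rule has_field_derivative_transform_within_open[OF _ openS z])
    have "(?h1 has_field_derivative
        6 * (wp z)^2 + 0 - 2 * (3 * (\<phi> z)^2 * (2 * wp z - (\<phi> z)^2))) (at z)"
      using DERIV_power[OF dphi[OF z], of 3]
      by (intro DERIV_diff DERIV_add wp_second_derivative[OF L[OF z]] DERIV_const DERIV_cmult)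
        (simp add: mult_ac)
    also have "6 * (wp z)^2 + 0 - 2 * (3 * (\<phi> z)^2 * (2 * wp z - (\<phi> z)^2)) = 6 * (H z)^2"
      unfolding Hphi[OF z] by algebra
    finally show "(?h1 has_field_derivative 6 * (H z)^2) (at z)" .
  qed (use H1 in auto)
  have ode_H: "deriv (deriv H) z = 6 * (H z)^2" if "z \<in> ball 0 r" for z
    by (rule analytic_continuation_open[where f = "deriv (deriv H)" and g = "\<lambda>z. 6 * (H z)^2",
          OF openS open_ball _ _ _ _ _ H2 that])
      (use H punctured_ball_nonempty[OF r] in \<open>auto intro!: holomorphic_intros\<close>)
  let ?k = "\<lambda>z. wp (z - \<alpha>)"
  let ?k1 = "\<lambda>z. deriv wp (z - \<alpha>)"
  have k: "(?k has_field_derivative ?k1 z) (at z)"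
    "(?k1 has_field_derivative 6 * (?k z)^2) (at z)" if "z \<in> ball 0 r" for z
    using DERIV_shift[of wp "?k1 z" z "- \<alpha>"] DERIV_shift[of "deriv wp" "6 * (?k z)^2" z "- \<alpha>"]
      wp_has_derivative[OF al[OF that]] wp_second_derivative[OF al[OF that]] by auto
  have k_hol: "?k holomorphic_on ball 0 r"
    unfolding holomorphic_on_open[OF open_ball] using k(1) by blast
  \<comment> \<open>The difference of two solutions of \<open>y'' = 6 y\<^sup>2\<close> solves a linear equation with coefficient \<open>6 (H + k)\<close>.\<close>
  have HK: "H z - ?k z = 0" if z: "z \<in> ball 0 r" for z
  proof (rule linear_ode2_zero[of r "\<lambda>z. H z - ?k z" "\<lambda>z. deriv H z - ?k1 z"
          "\<lambda>z. 6 * (H z + ?k z)"])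
    fix z :: complex assume z: "z \<in> ball 0 r"
    show "((\<lambda>z. H z - ?k z) has_field_derivative deriv H z - ?k1 z) (at z)"
      by (intro DERIV_diff holomorphic_derivI[OF H open_ball z] k(1)[OF z])
    have "(deriv H has_field_derivative 6 * (H z)^2) (at z)"
      using holomorphic_derivI[OF holomorphic_deriv[OF H open_ball] open_ball z] ode_H[OF z] by simp
    then have "((\<lambda>z. deriv H z - ?k1 z) has_field_derivative 6 * (H z)^2 - 6 * (?k z)^2) (at z)"
      by (intro DERIV_diff k(2)[OF z])
    then show "((\<lambda>z. deriv H z - ?k1 z) has_field_derivative 6 * (H z + ?k z) * (H z - ?k z)) (at z)"
      by (simp add: algebra_simps power2_eq_square)
  next
    show "(\<lambda>z. 6 * (H z + ?k z)) holomorphic_on ball 0 r"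
      using H k_hol by (intro holomorphic_intros)
    show "H 0 - wp (0 - \<alpha>) = 0" using alpha by (simp add: H_def wp_even)
    have "(H has_field_derivative 1 * K 0 + deriv K 0 * 0) (at 0)"
      unfolding H_def using r by (intro DERIV_mult DERIV_ident holomorphic_derivI[OF K open_ball]) auto
    then have "deriv H 0 = - 4" using DERIV_imp_deriv by (fastforce simp: K_def)
    then show "deriv H 0 - deriv wp (0 - \<alpha>) = 0" using alpha wp_deriv_odd by simp
  qed (rule z)
  show ?thesis
  proof (rule analytic_continuation_open[where f = "\<lambda>z. 2 * deriv wp z + 8"
          and g = "\<lambda>z. (wp z)^2 * wp (z - \<alpha>)", OF openS open_regular_domain _ connected_regular_domain _ _ _ _ z])
    show "?S \<noteq> {}" by (rule punctured_ball_nonempty[OF r])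
    show "?S \<subseteq> regular_domain"
      unfolding subset_iff regular_domain_iff using al L by blast
    have "wp holomorphic_on regular_domain" "deriv wp holomorphic_on regular_domain"
      using wp_holomorphic wp_deriv_holomorphic by (auto simp: regular_domain_iff elim!: holomorphic_on_subset)
    moreover have "?k holomorphic_on regular_domain"
      by (rule holomorphic_on_compose_gen[OF _ wp_holomorphic, of "\<lambda>z. z - \<alpha>", unfolded o_def])
        (auto intro!: holomorphic_intros simp: regular_domain_iff)
    ultimately show "(\<lambda>z. 2 * deriv wp z + 8) holomorphic_on regular_domain"
      "(\<lambda>z. (wp z)^2 * wp (z - \<alpha>)) holomorphic_on regular_domain"
      by (auto intro!: holomorphic_intros)
    fix z :: complex assume z: "z \<in> ?S"
    have "(2 * deriv wp z + 8) / (wp z)^2 = wp (z - \<alpha>)"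
      using phi_relation(1)[OF L[OF z] wpnz[OF z]] Hphi[OF z] HK[of z] z by simp
    then show "2 * deriv wp z + 8 = (wp z)^2 * wp (z - \<alpha>)"
      using wpnz[OF z] by (simp add: field_simps)
  qed
qed

text \<open>
  If \<open>\<wp>(\<alpha> + w)\<close> were nonzero, the right-hand side of \<open>wp_shift\<close> would have a double pole at
  \<open>\<alpha> + w\<close>, whereas the left-hand side stays bounded there.
\<close>
lemma wp_zero_at_translates:
  assumes w: "w \<in> L"
  shows "wp (\<alpha> + w) = 0"
proof -
  define s where "s = \<alpha> + w"
  have s: "s \<notin> L" using alpha(1) diff_L[of s w] w by (auto simp: s_def)
  define V where "V = - ((+) \<alpha> ` (L - {w})) \<inter> - L"
  have V: "open V" "s \<in> V"
    using closed_translate_L[of "L - {w}" \<alpha>] open_compl_L s by (auto simp: V_def s_def)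
  have VD: "z \<in> regular_domain" if "z \<in> V" "z \<noteq> s" for z
    using that unfolding regular_domain_def V_def s_def by auto
  have wps: "(wp \<longlongrightarrow> wp s) (at s)" "(deriv wp \<longlongrightarrow> deriv wp s) (at s)"
    using DERIV_isCont[OF wp_has_derivative[OF s]] DERIV_isCont[OF wp_second_derivative[OF s]]
    by (auto simp: isCont_def)
  have lim1: "((\<lambda>z. (z - s)^2 * (2 * deriv wp z + 8)) \<longlongrightarrow> (s - s)^2 * (2 * deriv wp s + 8)) (at s)"
    by (intro tendsto_intros wps)
  have lim2: "((\<lambda>z. (wp z)^2 * ((z - \<alpha> - w)^2 * wp (z - \<alpha>))) \<longlongrightarrow> (wp s)^2 * 1) (at s)"
  proof (intro tendsto_intros wps)
    have "filterlim (\<lambda>z. z - \<alpha>) (at w) (at s)"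
    proof (rule filterlim_atI)
      show "((\<lambda>z. z - \<alpha>) \<longlongrightarrow> w) (at s)"
        unfolding s_def by (auto intro!: tendsto_eq_intros)
      show "\<forall>\<^sub>F z in at s. z - \<alpha> \<noteq> w"
        using eventually_neq_at_within[of s s] by eventually_elim (auto simp: s_def)
    qed
    from filterlim_compose[OF wp_pole[OF w] this]
    show "((\<lambda>z. (z - \<alpha> - w)^2 * wp (z - \<alpha>)) \<longlongrightarrow> 1) (at s)" .
  qed
  have ev: "\<forall>\<^sub>F z in at s. (z - s)^2 * (2 * deriv wp z + 8) = (wp z)^2 * ((z - \<alpha> - w)^2 * wp (z - \<alpha>))"
    using eventually_at_in_open[OF V]
  proof eventually_elim
    case (elim z)
    then have "z \<in> regular_domain" using VD by blast
    then show ?case using wp_shift[of z] by (simp add: s_def mult_ac diff_diff_add)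
  qed
  have "(s - s)^2 * (2 * deriv wp s + 8) = (wp s)^2 * 1"
    by (rule tendsto_unique[OF at_neq_bot Lim_transform_eventually[OF lim1 ev] lim2])
  then show ?thesis by (simp add: s_def)
qed

text \<open>
  Near \<open>0\<close>, both \<open>\<zeta>(z - \<alpha>) - \<zeta>(z) + \<zeta>(\<alpha>)\<close> and \<open>\<phi>\<close> have the form \<open>- 1 / z\<close> plus a holomorphic
  function vanishing at \<open>0\<close>; for the former this uses that \<open>\<zeta>\<close> is odd. Their derivatives agree by
  \<open>wp_shift\<close>, and analytic continuation does the rest.
\<close>
lemma zeta_shift:
  assumes z: "z \<in> regular_domain"
  shows "2 * wp z * (zet (z - \<alpha>) - zet z + zet \<alpha>) = deriv wp z + 4"
proof -
  obtain r e p where r: "r > 0" and e: "e holomorphic_on ball 0 r" and p: "p holomorphic_on ball 0 r"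
    and e0: "e 0 = 0"
    and de: "\<And>z. z \<in> ball 0 r \<Longrightarrow> (e has_field_derivative - p z) (at z)"
    and nz: "\<And>z. z \<in> ball 0 r \<Longrightarrow> 1 + z^2 * p z \<noteq> 0"
    and al: "\<And>z. z \<in> ball 0 r \<Longrightarrow> z - \<alpha> \<notin> L"
    and L: "\<And>z. z \<in> ball 0 r - {0} \<Longrightarrow> z \<notin> L"
    and wp: "\<And>z. z \<in> ball 0 r - {0} \<Longrightarrow> wp z = (1 + z^2 * p z) / z^2"
    and zet: "\<And>z. z \<in> ball 0 r - {0} \<Longrightarrow> zet z = 1 / z + e z"
    and wp': "\<And>z. z \<in> ball 0 r - {0} \<Longrightarrow> deriv wp z = (- 2 + z^3 * deriv p z) / z^3"
    by (rule laurent_data_at_0) (rule that; assumption)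
  let ?S = "ball 0 r - {0} :: complex set"
  have openS: "open ?S" by auto
  have wpnz: "wp z \<noteq> 0" if "z \<in> ?S" for z
    using nz[of z] wp[OF that] that by auto
  \<comment> \<open>\<open>E\<close> is the holomorphic extension of \<open>\<phi> + 1 / z\<close> to \<open>0\<close>, and \<open>\<delta>\<close> that of the difference of the two sides.\<close>
  define E where "E = (\<lambda>z. (z^2 * deriv p z + 4 * z^2 + 2 * z * p z) / (2 * (1 + z^2 * p z)))"
  let ?\<psi> = "\<lambda>z. zet (z - \<alpha>) - zet z + zet \<alpha>"
  define \<delta> where "\<delta> = (\<lambda>z. zet (z - \<alpha>) + zet \<alpha> - e z - E z)"
  have dzet: "((\<lambda>z. zet (z - \<alpha>)) has_field_derivative - wp (z - \<alpha>)) (at z)" if "z - \<alpha> \<notin> L" for z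
    using DERIV_shift[of zet "- wp (z - \<alpha>)" z "- \<alpha>"] zeta_has_derivative[OF that] by simp
  have E: "E holomorphic_on ball 0 r"
    unfolding E_def
    by (intro holomorphic_intros holomorphic_deriv p open_ball) (metis nz mult_eq_0_iff zero_neq_numeral)
  have "(\<lambda>z. zet (z - \<alpha>)) holomorphic_on ball 0 r"
    unfolding holomorphic_on_open[OF open_ball] using dzet al by blast
  then have \<delta>: "\<delta> holomorphic_on ball 0 r"
    unfolding \<delta>_def using E e by (intro holomorphic_intros)
  have \<delta>_eq: "\<delta> z = ?\<psi> z - \<phi> z" if z: "z \<in> ?S" for z
  proof -
    define b where "b = 1 + z^2 * p z"
    have b: "b \<noteq> 0" "z \<noteq> 0" using nz z by (auto simp: b_def)
    have "\<phi> z = ((- 2 + z^3 * deriv p z) / z^3 + 4) / (2 * (b / z^2))"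
      unfolding \<phi>_def using wp[OF z] wp'[OF z] by (simp add: b_def)
    also have "\<dots> = (z^2 * deriv p z + 4 * z^2 + (2 * b - 2) / z) / (2 * b) - 1 / z"
      using b by (simp add: field_simps power2_eq_square power3_eq_cube)
    also have "(2 * b - 2) / z = 2 * z * p z"
      using b by (simp add: b_def field_simps power2_eq_square)
    finally have "\<phi> z = E z - 1 / z" by (simp add: E_def b_def)
    then show ?thesis using zet[OF z] by (simp add: \<delta>_def)
  qed
  have d\<delta>: "deriv \<delta> z = 0" if z: "z \<in> ?S" for z
  proof (rule DERIV_imp_deriv, rule has_field_derivative_transform_within_open[OF _ openS z])
    have "((\<lambda>z. ?\<psi> z - \<phi> z) has_field_derivative
        - wp (z - \<alpha>) - - wp z + 0 - (2 * wp z - (\<phi> z)^2)) (at z)"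
      using z al L wpnz
      by (intro DERIV_add DERIV_diff DERIV_const dzet zeta_has_derivative phi_has_derivative) auto
    moreover have "(\<phi> z)^2 - wp z = wp (z - \<alpha>)"
      using phi_relation(1)[OF L[OF z] wpnz[OF z]] wp_shift[of z] z al L wpnz[OF z]
      by (simp add: regular_domain_iff)
    ultimately show "((\<lambda>z. ?\<psi> z - \<phi> z) has_field_derivative 0) (at z)"
      by (simp add: algebra_simps)
  qed (use \<delta>_eq in auto)
  have S_ne: "?S \<noteq> {}" by (rule punctured_ball_nonempty[OF r])
  have "deriv \<delta> z = 0" if "z \<in> ball 0 r" for z
    by (rule analytic_continuation_open[where f = "deriv \<delta>" and g = "\<lambda>_. 0",
          OF openS open_ball S_ne _ _ _ _ d\<delta> that])
      (use \<delta> in \<open>auto intro!: holomorphic_intros\<close>)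
  then have "(\<delta> has_field_derivative 0) (at z within ball 0 r)" if "z \<in> ball 0 r" for z
    using holomorphic_derivI[OF \<delta> open_ball that] that by simp
  then obtain c where c: "\<And>z. z \<in> ball 0 r \<Longrightarrow> \<delta> z = c"
    using has_field_derivative_zero_constant[of "ball 0 r" \<delta>] by auto
  have "\<delta> 0 = 0" by (simp add: \<delta>_def e0 E_def zeta_odd)
  then have \<delta>0: "\<delta> z = 0" if "z \<in> ball 0 r" for z using c[OF that] c[of 0] r by simp
  show ?thesis
  proof (rule analytic_continuation_open[where f = "\<lambda>z. 2 * wp z * ?\<psi> z"
          and g = "\<lambda>z. deriv wp z + 4", OF openS open_regular_domain S_ne connected_regular_domain _ _ _ _ z])
    show "?S \<subseteq> regular_domain"
      unfolding subset_iff regular_domain_iff using al L by blast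
    have "wp holomorphic_on regular_domain" "deriv wp holomorphic_on regular_domain"
      using wp_holomorphic wp_deriv_holomorphic by (auto simp: regular_domain_iff elim!: holomorphic_on_subset)
    moreover have "zet holomorphic_on regular_domain" "(\<lambda>z. zet (z - \<alpha>)) holomorphic_on regular_domain"
      unfolding holomorphic_on_open[OF open_regular_domain] using zeta_has_derivative dzet regular_domain_iff by blast+
    ultimately show "(\<lambda>z. 2 * wp z * ?\<psi> z) holomorphic_on regular_domain"
      "(\<lambda>z. deriv wp z + 4) holomorphic_on regular_domain"
      by (auto intro!: holomorphic_intros)
    fix z :: complex assume z: "z \<in> ?S"
    have "?\<psi> z = \<phi> z" using \<delta>_eq[OF z] \<delta>0[of z] z by simp
    then show "2 * wp z * ?\<psi> z = deriv wp z + 4"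
      using wpnz[OF z] by (simp add: \<phi>_def)
  qed
qed

lemma regular_domainI: "z \<notin> L \<Longrightarrow> wp z \<noteq> 0 \<Longrightarrow> z \<in> regular_domain"
  using wp_zero_at_translates[of "z - \<alpha>"] by (auto simp: regular_domain_iff)

section \<open>The second column of the frame\<close>

text \<open>
  A Hermite-Halphen solution of the Lame equation \<open>y'' = 2 \<wp>(t + \<beta>) y\<close>; the reciprocal of its cube
  appears in the integrand of \<open>q\<close>.
\<close>
definition lame :: "complex \<Rightarrow> complex \<Rightarrow> complex" where
  "lame \<beta> t = sig (t + \<beta> - \<alpha>) / sig (t + \<beta>) * exp (zet \<alpha> * t)"

text \<open>
  Off \<open>Lambda_tilde\<close> the numerator \<open>\<sigma>(t + \<beta> - \<alpha>)\<close> cannot vanish, because all points of \<open>\<alpha> + L\<close> are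
  zeros of \<open>\<wp>\<close>.
\<close>
lemma lame_nonzero:
  assumes "t \<notin> Lambda_tilde \<omega>1 \<omega>2 \<beta>"
  shows "lame \<beta> t \<noteq> 0"
  using assms regular_domainI[of "t + \<beta>"] sigma_nonzero[of "t + \<beta>"] sigma_nonzero[of "t + \<beta> - \<alpha>"]
  by (auto simp: lame_def Lambda_tilde_def regular_domain_iff)

lemma lame_has_derivative:
  assumes "t \<notin> Lambda_tilde \<omega>1 \<omega>2 \<beta>"
  shows "(lame \<beta> has_field_derivative \<phi> (t + \<beta>) * lame \<beta> t) (at t)"
proof -
  define z where "z = t + \<beta>"
  have z: "z \<notin> L" "wp z \<noteq> 0" using assms by (auto simp: Lambda_tilde_def z_def)
  note D = regular_domainI[OF z]
  have za: "z - \<alpha> \<notin> L" using D by (simp add: regular_domain_iff)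
  have nz: "sig z \<noteq> 0" by (rule sigma_nonzero[OF z(1)])
  have 1: "((\<lambda>t. sig (t + \<beta> - \<alpha>)) has_field_derivative zet (z - \<alpha>) * sig (z - \<alpha>)) (at t)"
    using DERIV_shift[of sig _ t "\<beta> - \<alpha>"] sigma_has_derivative[OF za]
    by (simp add: z_def algebra_simps)
  have 2: "((\<lambda>t. sig (t + \<beta>)) has_field_derivative zet z * sig z) (at t)"
    using DERIV_shift[of sig _ t \<beta>] sigma_has_derivative[OF z(1)] by (simp add: z_def)
  have 3: "((\<lambda>t. exp (zet \<alpha> * t)) has_field_derivative exp (zet \<alpha> * t) * zet \<alpha>) (at t)"
    by (auto intro!: derivative_eq_intros)
  have "(lame \<beta> has_field_derivative
      (zet (z - \<alpha>) * sig (z - \<alpha>) * sig z - sig (z - \<alpha>) * (zet z * sig z)) / (sig z * sig z)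
        * exp (zet \<alpha> * t) + exp (zet \<alpha> * t) * zet \<alpha> * (sig (z - \<alpha>) / sig z)) (at t)"
    unfolding lame_def[abs_def]
    using DERIV_mult[OF DERIV_divide[OF 1 2] 3] nz by (simp add: z_def)
  also have "(zet (z - \<alpha>) * sig (z - \<alpha>) * sig z - sig (z - \<alpha>) * (zet z * sig z)) / (sig z * sig z)
        * exp (zet \<alpha> * t) + exp (zet \<alpha> * t) * zet \<alpha> * (sig (z - \<alpha>) / sig z)
      = (zet (z - \<alpha>) - zet z + zet \<alpha>) * (sig (z - \<alpha>) / sig z * exp (zet \<alpha> * t))"
    using nz by (simp add: field_simps)
  also have "zet (z - \<alpha>) - zet z + zet \<alpha> = \<phi> z"
    using zeta_shift[OF D] z(2) by (simp add: \<phi>_def field_simps)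
  finally show ?thesis by (simp add: lame_def[abs_def] z_def)
qed

lemma q_integrand_eq:
  "q_integrand \<omega>1 \<omega>2 \<alpha> \<beta> t s = (t - s) / (lame \<beta> s)^3"
proof -
  have "exp (- 3 * zet \<alpha> * s) = 1 / exp (zet \<alpha> * s) ^ 3"
    by (simp add: exp_minus divide_inverse mult.assoc flip: exp_of_nat_mult)
  then show ?thesis
    by (simp add: q_integrand_def lame_def power_divide power_mult_distrib)
qed

text \<open>
  Write \<open>p2 = G w\<close>, where \<open>G\<close> is the function \<open>lame\<close>. Then \<open>N1 / G\<close> and \<open>N2 / G\<close> below are \<open>w'\<close> and \<open>w''\<close>, expressed through the
  entries of the row so that no second derivatives occur. The relation \<open>N2' = - 2 \<phi> N2\<close> makes
  \<open>N2 G\<^sup>2\<close>, which is \<open>w'' G\<^sup>3\<close>, locally constant.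
\<close>
lemma frame_row_second_entry:
  fixes p1 p2 p3 :: "complex \<Rightarrow> complex" and a :: complex
  assumes a: "a \<noteq> 0"
    and p1: "\<And>t. t \<notin> Lambda_tilde \<omega>1 \<omega>2 \<beta> \<Longrightarrow>
      (p1 has_field_derivative - (deriv wp (t + \<beta>) / wp (t + \<beta>)) * p1 t - 2 / a * p2 t) (at t)"
    and p2: "\<And>t. t \<notin> Lambda_tilde \<omega>1 \<omega>2 \<beta> \<Longrightarrow> (p2 has_field_derivative - (2 / a) * p3 t) (at t)"
    and p3: "\<And>t. t \<notin> Lambda_tilde \<omega>1 \<omega>2 \<beta> \<Longrightarrow>
      (p3 has_field_derivative - 2 * a^2 * p1 t + deriv wp (t + \<beta>) / wp (t + \<beta>) * p3 t) (at t)"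
    and q: "is_q \<omega>1 \<omega>2 \<alpha> \<beta> q" and zero: "0 \<notin> Lambda_tilde \<omega>1 \<omega>2 \<beta>"
    and x: "x \<notin> Lambda_tilde \<omega>1 \<omega>2 \<beta>"
  shows "p2 x = lame \<beta> x * ((p2 0 + x * (- (2 / a) * p3 0 - \<phi> \<beta> * p2 0)) / lame \<beta> 0
      + (4 * a * p1 0 + 8 / (a * wp \<beta>) * p3 0 + (2 * (\<phi> \<beta>)^2 - 2 * wp \<beta>) * p2 0)
          * (lame \<beta> 0)^2 * q x)"
proof -
  let ?\<Lambda> = "Lambda_tilde \<omega>1 \<omega>2 \<beta>"
  define N1 where "N1 t = - (2 / a) * p3 t - \<phi> (t + \<beta>) * p2 t" for t
  define N2 where "N2 t = 4 * a * p1 t + 8 / a * (p3 t / wp (t + \<beta>))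
      + (2 * (\<phi> (t + \<beta>))^2 - 2 * wp (t + \<beta>)) * p2 t" for t
  define K where "K = N2 0 * (lame \<beta> 0)^2"
  have z: "t + \<beta> \<notin> L" "wp (t + \<beta>) \<noteq> 0" if "t \<notin> ?\<Lambda>" for t
    using that by (auto simp: Lambda_tilde_def)
  have d\<phi>: "((\<lambda>t. \<phi> (t + \<beta>)) has_field_derivative 2 * wp (t + \<beta>) - (\<phi> (t + \<beta>))^2) (at t)"
    if "t \<notin> ?\<Lambda>" for t
    using DERIV_shift[of \<phi> _ t \<beta>] phi_has_derivative[OF z[OF that]] by simp
  have dwp: "((\<lambda>t. wp (t + \<beta>)) has_field_derivative deriv wp (t + \<beta>)) (at t)" if "t \<notin> ?\<Lambda>" for t
    using DERIV_shift[of wp _ t \<beta>] wp_has_derivative[OF z(1)[OF that]] by simp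
  have N1': "(N1 has_field_derivative N2 t + \<phi> (t + \<beta>) * N1 t) (at t)" if t: "t \<notin> ?\<Lambda>" for t
  proof -
    define P D F where "P = wp (t + \<beta>)" and "D = deriv wp (t + \<beta>)" and "F = \<phi> (t + \<beta>)"
    have P: "P \<noteq> 0" and D: "D = 2 * P * F - 4"
      using z[OF t] phi_relation(2)[OF z[OF t]] by (auto simp: P_def D_def F_def)
    have "(N1 has_field_derivative - (2 / a) * (- 2 * a^2 * p1 t + D / P * p3 t)
         - ((2 * P - F^2) * p2 t + - (2 / a) * p3 t * F)) (at t)"
      unfolding N1_def[abs_def] P_def D_def F_def
      by (intro DERIV_diff DERIV_cmult DERIV_mult p3 d\<phi> p2 t)
    also have "- (2 / a) * (- 2 * a^2 * p1 t + D / P * p3 t)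
         - ((2 * P - F^2) * p2 t + - (2 / a) * p3 t * F)
       = (4 * a * p1 t + 8 / a * (p3 t / P) + (2 * F^2 - 2 * P) * p2 t)
         + F * (- (2 / a) * p3 t - F * p2 t)"
      unfolding D using a P by (simp add: field_simps power2_eq_square)
    also have "\<dots> = N2 t + \<phi> (t + \<beta>) * N1 t" by (simp only: N1_def N2_def P_def F_def)
    finally show ?thesis .
  qed
  have N2': "(N2 has_field_derivative - 2 * \<phi> (t + \<beta>) * N2 t) (at t)" if t: "t \<notin> ?\<Lambda>" for t
  proof -
    define P D F where "P = wp (t + \<beta>)" and "D = deriv wp (t + \<beta>)" and "F = \<phi> (t + \<beta>)"
    have P: "P \<noteq> 0" and D: "D = 2 * P * F - 4"
      using z[OF t] phi_relation(2)[OF z[OF t]] by (auto simp: P_def D_def F_def)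
    have F2: "F^2 = P + 4 * F / P"
    proof -
      have "F^2 - P = (2 * D + 8) / P^2"
        unfolding P_def D_def F_def by (rule phi_relation(1)[OF z[OF t]])
      also have "2 * D + 8 = 4 * F * P" unfolding D by simp
      also have "4 * F * P / P^2 = 4 * F / P" using P by (simp add: power2_eq_square)
      finally show ?thesis by (simp add: algebra_simps)
    qed

    have "(N2 has_field_derivative 4 * a * (- (D / P) * p1 t - 2 / a * p2 t)
       + 8 / a * (((- 2 * a^2 * p1 t + D / P * p3 t) * P - p3 t * D) / (P * P))
       + ((2 * (2 * F * (2 * P - F^2)) - 2 * D) * p2 t + - (2 / a) * p3 t * (2 * F^2 - 2 * P))) (at t)"
      unfolding N2_def[abs_def] P_def D_def F_def
      using DERIV_power[OF d\<phi>[OF t], of 2] z(2)[OF t]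
      by (intro DERIV_diff DERIV_add DERIV_cmult DERIV_mult DERIV_divide p1 p2 p3 dwp t) (auto simp: mult_ac)
    also have "4 * a * (- (D / P) * p1 t - 2 / a * p2 t)
       + 8 / a * (((- 2 * a^2 * p1 t + D / P * p3 t) * P - p3 t * D) / (P * P))
       + ((2 * (2 * F * (2 * P - F^2)) - 2 * D) * p2 t + - (2 / a) * p3 t * (2 * F^2 - 2 * P))
      = - 2 * F * (4 * a * p1 t + 8 / a * (p3 t / P) + (2 * F^2 - 2 * P) * p2 t)"
    proof -
      have c1: "4 * a * (- (D / P)) - 8 / a * (2 * a^2 / P) = - 2 * F * (4 * a)"
        unfolding D using a P by (simp add: field_simps power2_eq_square)
      have c2: "4 * a * (- 2 / a) + (2 * (2 * F * (2 * P - F^2)) - 2 * D) = - 2 * F * (2 * F^2 - 2 * P)"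
        unfolding D using a by (simp add: algebra_simps)
      have c3: "- (2 / a) * (2 * F^2 - 2 * P) = - 2 * F * (8 / a / P)"
        unfolding F2 by (simp add: algebra_simps)
      have "4 * a * (- (D / P) * p1 t - 2 / a * p2 t)
         + 8 / a * (((- 2 * a^2 * p1 t + D / P * p3 t) * P - p3 t * D) / (P * P))
         + ((2 * (2 * F * (2 * P - F^2)) - 2 * D) * p2 t + - (2 / a) * p3 t * (2 * F^2 - 2 * P))
        = (4 * a * (- (D / P)) - 8 / a * (2 * a^2 / P)) * p1 t
         + (4 * a * (- 2 / a) + (2 * (2 * F * (2 * P - F^2)) - 2 * D)) * p2 t
         + (- (2 / a) * (2 * F^2 - 2 * P)) * p3 t"
        using P by (simp add: algebra_simps)
      also have "\<dots> = - 2 * F * (4 * a * p1 t + 8 / a * (p3 t / P) + (2 * F^2 - 2 * P) * p2 t)"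
        unfolding c1 c2 c3 by (simp add: algebra_simps)
      finally show ?thesis .
    qed
    also have "\<dots> = - 2 * \<phi> (t + \<beta>) * N2 t" by (simp only: N2_def P_def F_def)
    finally show ?thesis .
  qed
  \<comment> \<open>The paths that come with \<open>q\<close> also connect every admissible point to \<open>0\<close>, so local constancy gives constancy.\<close>
  have path: "\<exists>\<gamma>. valid_path \<gamma> \<and> pathstart \<gamma> = 0 \<and> pathfinish \<gamma> = t \<and> path_image \<gamma> \<subseteq> - ?\<Lambda> \<and>
      (q_integrand \<omega>1 \<omega>2 \<alpha> \<beta> t has_contour_integral q t) \<gamma>" if "t \<notin> ?\<Lambda>" for t
    using q that unfolding is_q_def by blast
  have K: "N2 t = K / (lame \<beta> t)^2" if t: "t \<notin> ?\<Lambda>" for t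
  proof -
    obtain \<gamma> where \<gamma>: "valid_path \<gamma>" "pathstart \<gamma> = 0" "pathfinish \<gamma> = t" "path_image \<gamma> \<subseteq> - ?\<Lambda>"
      using path[OF t] by blast
    have "((\<lambda>s. N2 s * (lame \<beta> s)^2) has_field_derivative 0) (at s within - ?\<Lambda>)" if "s \<in> - ?\<Lambda>" for s
    proof -
      have s: "s \<notin> ?\<Lambda>" using that by simp
      have "((\<lambda>s. N2 s * (lame \<beta> s)^2) has_field_derivative
          - 2 * \<phi> (s + \<beta>) * N2 s * (lame \<beta> s)^2 + 2 * lame \<beta> s * (\<phi> (s + \<beta>) * lame \<beta> s) * N2 s) (at s)"
        using DERIV_power[OF lame_has_derivative[OF s], of 2]
        by (intro DERIV_mult N2' s) (simp add: mult_ac)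
      then have "((\<lambda>s. N2 s * (lame \<beta> s)^2) has_field_derivative 0) (at s)"
        by (simp add: power2_eq_square mult_ac)
      then show ?thesis by (rule has_field_derivative_at_within)
    qed
    from contour_integral_primitive[OF this \<gamma>(1,4)]
    have "N2 t * (lame \<beta> t)^2 = N2 0 * (lame \<beta> 0)^2"
      using has_contour_integral_unique[OF _ has_contour_integral_0] \<gamma>(2,3) by force
    then show ?thesis using lame_nonzero[OF t] by (simp add: K_def field_simps)
  qed
  obtain \<gamma> where \<gamma>: "valid_path \<gamma>" "pathstart \<gamma> = 0" "pathfinish \<gamma> = x" "path_image \<gamma> \<subseteq> - ?\<Lambda>"
    and int: "(q_integrand \<omega>1 \<omega>2 \<alpha> \<beta> x has_contour_integral q x) \<gamma>"
    using path[OF x] by blast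
  \<comment> \<open>Integration by parts: \<open>(x - s) w' + w\<close> is a single-valued primitive of \<open>(x - s) w''\<close> in \<open>s\<close>.\<close>
  let ?F = "\<lambda>s. (x - s) * (N1 s / lame \<beta> s) + p2 s / lame \<beta> s"
  have "(?F has_field_derivative K * q_integrand \<omega>1 \<omega>2 \<alpha> \<beta> x s) (at s within - ?\<Lambda>)"
    if "s \<in> - ?\<Lambda>" for s
  proof -
    have s: "s \<notin> ?\<Lambda>" using that by simp
    note Gs = lame_nonzero[OF s] and dG = lame_has_derivative[OF s]
    define g F where "g = lame \<beta> s" and "F = \<phi> (s + \<beta>)"
    have g: "g \<noteq> 0" using Gs by (simp add: g_def)
    have N1s: "- (2 / a) * p3 s = N1 s + F * p2 s" by (simp add: N1_def F_def)
    have d1: "((\<lambda>s. N1 s / lame \<beta> s) has_field_derivative N2 s / g) (at s)"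
    proof -
      have "((\<lambda>s. N1 s / lame \<beta> s) has_field_derivative ((N2 s + F * N1 s) * g - N1 s * (F * g)) / (g * g)) (at s)"
        unfolding g_def F_def by (rule DERIV_divide[OF N1'[OF s] dG Gs])
      also have "((N2 s + F * N1 s) * g - N1 s * (F * g)) / (g * g) = N2 s / g"
        using g by (simp add: field_simps)
      finally show ?thesis .
    qed
    have d0: "((\<lambda>s. p2 s / lame \<beta> s) has_field_derivative N1 s / g) (at s)"
    proof -
      have "((\<lambda>s. p2 s / lame \<beta> s) has_field_derivative (- (2 / a) * p3 s * g - p2 s * (F * g)) / (g * g)) (at s)"
        unfolding g_def F_def by (rule DERIV_divide[OF p2[OF s] dG Gs])
      also have "(- (2 / a) * p3 s * g - p2 s * (F * g)) / (g * g) = N1 s / g"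
        unfolding N1s using g by (simp add: field_simps)
      finally show ?thesis .
    qed
    have dx: "((\<lambda>s. x - s) has_field_derivative - 1) (at s)"
      by (auto intro!: derivative_eq_intros)
    have "(?F has_field_derivative - 1 * (N1 s / lame \<beta> s) + N2 s / g * (x - s) + N1 s / g) (at s)"
      by (intro DERIV_add DERIV_mult d0 d1 dx)
    also have "- 1 * (N1 s / lame \<beta> s) + N2 s / g * (x - s) + N1 s / g = K * q_integrand \<omega>1 \<omega>2 \<alpha> \<beta> x s"
      unfolding K[OF s] q_integrand_eq by (simp add: g_def power2_eq_square power3_eq_cube)
    finally show ?thesis by (rule has_field_derivative_at_within)
  qed
  from contour_integral_primitive[OF this \<gamma>(1,4)]
  have "((\<lambda>s. K * q_integrand \<omega>1 \<omega>2 \<alpha> \<beta> x s) has_contour_integral (?F x - ?F 0)) \<gamma>"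
    by (simp only: \<gamma>(2,3))
  from has_contour_integral_unique[OF this has_contour_integral_lmul[OF int, of K]]
  have "p2 x / lame \<beta> x = p2 0 / lame \<beta> 0 + x * (N1 0 / lame \<beta> 0) + K * q x"
    by (simp add: algebra_simps)
  then have "p2 x = lame \<beta> x * (p2 0 / lame \<beta> 0 + x * (N1 0 / lame \<beta> 0) + K * q x)"
    using lame_nonzero[OF x] by (simp add: field_simps)
  then show ?thesis
    by (simp add: N1_def N2_def K_def add_divide_distrib)
qed

end

section \<open>The nilpotent exponential and the base change\<close>

lemma mat_exp_nilpotent:
  fixes Y :: "complex^3^3"
  assumes Y: "Y ** (Y ** Y) = 0"
  shows "mat_exp Y *v v = v + Y *v v + cscale (1 / 2) (Y ** Y) *v v"
proof -
  have "mat_power Y n = 0" if "n \<notin> {0, 1, 2}" for n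
  proof -
    have "3 \<le> n" using that by auto
    then obtain k where "n = Suc (Suc (Suc k))"
      by (metis add.commute le_Suc_ex numeral_3_eq_3 add_Suc_right add_0_right)
    then have "mat_power Y n = (Y ** (Y ** Y)) ** mat_power Y k"
      by (simp add: matrix_mul_assoc)
    then show ?thesis
      unfolding Y by (simp add: matrix_matrix_mult_def vec_eq_iff)
  qed
  then have "mat_exp Y = (\<Sum>n\<in>{0, 1, 2}. cscale (1 / fact n) (mat_power Y n))"
    unfolding mat_exp_def by (intro suminf_finite) (auto simp: cscale_def vec_eq_iff)
  also have "\<dots> = mat 1 + Y + cscale (1 / 2) (Y ** Y)"
    by (simp add: numeral_2_eq_2 cscale_def vec_eq_iff)
  finally show ?thesis by (simp add: matrix_vector_mult_add_rdistrib)
qed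

lemma vector3_mult_vec:
  fixes a b c d e f g h i x y z :: complex
  shows "(vector [vector [a, b, c], vector [d, e, f], vector [g, h, i]] :: complex^3^3) *v vector [x, y, z]
    = vector [a * x + b * y + c * z, d * x + e * y + f * z, g * x + h * y + i * z]"
  by (simp add: vec_eq_iff forall_3 matrix_vector_mult_def sum_3 vector_3)

lemma cscale_mult_vec: "cscale c A *v v = c *s (A *v v)"
  by (simp add: vec_eq_iff cscale_def matrix_vector_mult_def sum_distrib_left mult.assoc)

lemma vec3_eta: "v = vector [v $ 1, v $ 2, (v :: complex^3) $ 3]"
  by (simp add: vec_eq_iff forall_3 vector_3)

lemma matrix_eq_if_mult_vec_eq:
  fixes A B :: "complex^3^3"
  assumes "\<And>v. A *v v = B *v v" shows "A = B"
  using assms matrix_eq by blast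

lemma scale_vector3: "c *s (vector [x, y, z] :: complex^3) = vector [c * x, c * y, c * z]"
  by (simp add: vec_eq_iff forall_3 vector_3)

lemma add_vector3: "(vector [x, y, z] :: complex^3) + vector [x', y', z'] = vector [x + x', y + y', z + z']"
  by (simp add: vec_eq_iff forall_3 vector_3)

lemma X_matrix_mult_vec:
  "X_matrix a m *v vector [x, y, z] = vector [of_real m * x - y / of_real a + (of_real a)^2 * z,
     (x - z) / of_real a, - ((of_real a)^2) * x + y / of_real a - of_real m * z]"
  unfolding X_matrix_def Let_def vector3_mult_vec
  by (simp add: diff_divide_distrib)

text \<open>
  By Cayley-Hamilton: the trace and the determinant of \<open>X\<close> are zero, and the hypothesis on \<open>m\<close> says that the
  sum of its principal 2 by 2 minors vanishes as well. The equation is checked on vectors.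
\<close>
lemma X_matrix_nilpotent:
  fixes a m :: real
  assumes a: "a \<noteq> 0" and m: "m^2 = a^4 + 2 / a^2"
  shows "X_matrix a m *v (X_matrix a m *v (X_matrix a m *v v)) = 0"
proof -
  define A B M where "A = complex_of_real a" and "B = 1 / complex_of_real a" and "M = complex_of_real m"
  have AB: "A * B = 1" using a by (simp add: A_def B_def)
  have M: "M * M = A * A * (A * A) + 2 * (B * B)"
    using arg_cong[OF m, of complex_of_real]
    by (simp add: A_def B_def M_def power_divide power4_eq_xxxx power2_eq_square mult.assoc)
  have X: "X_matrix a m *v vector [x, y, z] = vector [M * x - B * y + A * A * z,
     B * (x - z), - A * A * x + B * y - M * z]" for x y z
    unfolding X_matrix_mult_vec by (simp add: A_def B_def M_def power2_eq_square)
  obtain x y z where v: "v = vector [x, y, z]" using vec3_eta by blast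
  have "X_matrix a m *v (X_matrix a m *v (X_matrix a m *v v)) = vector [0, 0, 0]"
    unfolding v X
  proof (intro arg_cong[of _ _ vector] list.inject[THEN iffD2] conjI refl)
    let ?x1 = "M * x - B * y + A * A * z" and ?y1 = "B * (x - z)" and ?z1 = "- A * A * x + B * y - M * z"
    let ?x2 = "M * ?x1 - B * ?y1 + A * A * ?z1" and ?y2 = "B * (?x1 - ?z1)"
      and ?z2 = "- A * A * ?x1 + B * ?y1 - M * ?z1"
    show "M * ?x2 - B * ?y2 + A * A * ?z2 = 0" using AB M by algebra
    show "B * (?x2 - ?z2) = 0" using AB M by algebra
    show "- A * A * ?x2 + B * ?y2 - M * ?z2 = 0" using AB M by algebra
  qed
  then show ?thesis by (simp add: vec_eq_iff forall_3 vector_3)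
qed

context equianharmonic begin

lemma frame_row_equations:
  fixes Phi :: "complex \<Rightarrow> complex^3^3" and i :: 3
  assumes "is_frame \<omega>1 \<omega>2 \<beta> a Phi" and t: "t \<notin> Lambda_tilde \<omega>1 \<omega>2 \<beta>"
  defines "u \<equiv> deriv wp (t + \<beta>) / wp (t + \<beta>)" and "A \<equiv> complex_of_real a"
  shows "((\<lambda>s. Phi s $ i $ 1) has_field_derivative - u * Phi t $ i $ 1 - 2 / A * Phi t $ i $ 2) (at t)"
    and "((\<lambda>s. Phi s $ i $ 2) has_field_derivative - (2 / A) * Phi t $ i $ 3) (at t)"
    and "((\<lambda>s. Phi s $ i $ 3) has_field_derivative - 2 * A^2 * Phi t $ i $ 1 + u * Phi t $ i $ 3) (at t)"
proof -
  have d: "((\<lambda>s. Phi s $ i $ j) has_field_derivative (Phi t ** frame_coeff \<omega>1 \<omega>2 \<beta> a t) $ i $ j) (at t)" for j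
    using assms(1) t unfolding is_frame_def by blast
  have C: "frame_coeff \<omega>1 \<omega>2 \<beta> a t = vector [vector [- u, 0, - 2 * A^2], vector [- 2 / A, 0, 0],
      vector [0, - 2 / A, u]]"
    by (simp add: frame_coeff_def Let_def u_def A_def)
  show "((\<lambda>s. Phi s $ i $ 1) has_field_derivative - u * Phi t $ i $ 1 - 2 / A * Phi t $ i $ 2) (at t)"
    using d[of 1] unfolding C by (simp add: matrix_matrix_mult_def sum_3 vector_3 mult_ac)
  show "((\<lambda>s. Phi s $ i $ 2) has_field_derivative - (2 / A) * Phi t $ i $ 3) (at t)"
    using d[of 2] unfolding C by (simp add: matrix_matrix_mult_def sum_3 vector_3 mult_ac)
  show "((\<lambda>s. Phi s $ i $ 3) has_field_derivative - 2 * A^2 * Phi t $ i $ 1 + u * Phi t $ i $ 3) (at t)"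
    using d[of 3] unfolding C by (simp add: matrix_matrix_mult_def sum_3 vector_3 mult_ac)
qed

text \<open>
  The three rows of the frame start at \<open>(1, 0, 0)\<close>, \<open>(0, 1, 0)\<close> and \<open>(0, 0, 1)\<close>. The values of \<open>\<wp>\<close> and
  \<open>\<wp>'\<close> at \<open>\<beta>\<close> give \<open>\<phi>(\<beta>) = m + a\<^sup>2\<close>, and the condition on \<open>m\<close> turns
  \<open>2 \<phi>(\<beta>)\<^sup>2 - 2 \<wp>(\<beta>)\<close> into \<open>4 a\<^sup>2 (m + a\<^sup>2)\<close>.
\<close>
lemma frame_second_column:
  fixes a m :: real
  assumes a: "a > 0" and m: "m^2 = a^4 + 2 / a^2"
    and beta: "\<beta> \<notin> L" "wp \<beta> = of_real (2 / a^2)" "deriv wp \<beta> = of_real (4 * m / a^2)"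
    and frame: "is_frame \<omega>1 \<omega>2 \<beta> a Phi" and q: "is_q \<omega>1 \<omega>2 \<alpha> \<beta> q"
    and t: "t \<notin> Lambda_tilde \<omega>1 \<omega>2 \<beta>"
  defines "A \<equiv> complex_of_real a" and "M \<equiv> complex_of_real m" and "g \<equiv> lame \<beta> 0"
  shows "Phi t *v vector [0, 1, 0] = (lame \<beta> t / g) *s vector [4 * A * (g^3 * q t),
    1 - (M + A^2) * t + 4 * A^2 * (M + A^2) * (g^3 * q t), - (2 / A) * t + 4 * A * (g^3 * q t)]"
proof -
  have A: "A \<noteq> 0" using a by (simp add: A_def)
  have wpb: "wp \<beta> = 2 / A^2" "deriv wp \<beta> = 4 * M / A^2"
    using beta by (simp_all add: A_def M_def)
  have zero: "0 \<notin> Lambda_tilde \<omega>1 \<omega>2 \<beta>"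
    using beta(1) wpb A by (simp add: Lambda_tilde_def)
  have g: "g \<noteq> 0" unfolding g_def by (rule lame_nonzero[OF zero])
  have \<phi>: "\<phi> \<beta> = M + A^2"
    using A by (simp add: \<phi>_def wpb field_simps)
  have M2: "M^2 = A^4 + 2 / A^2"
    using arg_cong[OF m, of complex_of_real] by (simp add: A_def M_def)
  have c3: "8 / (A * wp \<beta>) = 4 * A"
    using A by (simp add: wpb field_simps power2_eq_square)
  have c2: "2 * (M + A^2)^2 - 2 * wp \<beta> = 4 * A^2 * (M + A^2)"
  proof -
    have sq: "(M + A^2)^2 = M^2 + 2 * M * A^2 + A^4" by (simp add: power2_sum flip: power_mult)
    show ?thesis unfolding sq wpb M2 by (simp add: algebra_simps power2_eq_square power4_eq_xxxx)
  qed
  have entry: "Phi t $ i $ 2 = lame \<beta> t * ((Phi 0 $ i $ 2 + t * (- (2 / A) * Phi 0 $ i $ 3 - (M + A^2) * Phi 0 $ i $ 2)) / g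
      + (4 * A * Phi 0 $ i $ 1 + 4 * A * Phi 0 $ i $ 3 + 4 * A^2 * (M + A^2) * Phi 0 $ i $ 2) * g^2 * q t)" for i
  proof -
    note row = frame_row_second_entry[of A \<beta> "\<lambda>s. Phi s $ i $ 1" "\<lambda>s. Phi s $ i $ 2"
        "\<lambda>s. Phi s $ i $ 3" q t, OF A _ _ _ q zero t]
    show ?thesis
      using row[OF frame_row_equations[OF frame, folded A_def]] unfolding \<phi> c2 c3 g_def by blast
  qed
  have Phi0: "Phi 0 = mat 1" using frame by (simp add: is_frame_def)
  have col: "Phi t *v vector [0, 1, 0] = vector [Phi t $ 1 $ 2, Phi t $ 2 $ 2, Phi t $ 3 $ 2]"
    by (simp add: vec_eq_iff forall_3 matrix_vector_mult_def sum_3 vector_3)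
  have "x / g + y * g^2 * r = 1 / g * (x + y * (g^3 * r))" for x y r
    using g by (simp add: field_simps power2_eq_square power3_eq_cube)
  note factor = this
  show ?thesis
    unfolding col entry Phi0 factor scale_vector3
    by (simp add: mat_def algebra_simps)
qed

end

text \<open>
  Let \<open>e = (0, 1, 0)\<close> and write the column as \<open>k (e + x b + Q c)\<close>. Then \<open>X c = 0\<close> and
  \<open>X (X e) = - X b\<close>, so the coefficient of \<open>X b\<close> in \<open>exp(z X)\<close> applied to this sum is
  \<open>z x - z\<^sup>2 / 2 = (x\<^sup>2 + y\<^sup>2) / 2\<close>, the remaining part being \<open>e + x b + Q c + z X e\<close>.
\<close>
lemma exp_z_is_quadratic:
  fixes a m x y :: real and k Q :: complex
  assumes a: "a > 0" and m: "m^2 = a^4 + 2 / a^2"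
  defines "A \<equiv> complex_of_real a" and "M \<equiv> complex_of_real m" and "X \<equiv> complex_of_real x"
    and "N \<equiv> complex_of_real (x^2 + y^2)"
  shows "mat_exp (cscale (Complex x y) (X_matrix a m)) *v
     (k *s vector [4 * A * Q, 1 - (M + A^2) * X + 4 * A^2 * (M + A^2) * Q, - (2 / A) * X + 4 * A * Q])
   = k *s vector [4 * A * Q - Complex x y / A + N * (M - A^2) / (2 * A),
        1 - (M + A^2) * X + 4 * A^2 * (M + A^2) * Q + N / A^2,
        - (2 / A) * X + 4 * A * Q + Complex x y / A + N * (M - A^2) / (2 * A)]"
proof -
  define B z where "B = 1 / A" and "z = Complex x y"
  have A0: "A \<noteq> 0" using a by (simp add: A_def)
  have AB: "A * B = 1" using A0 by (simp add: B_def)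
  have M2: "M^2 = A^4 + 2 * B^2"
    using arg_cong[OF m, of complex_of_real] by (simp add: A_def B_def M_def power_divide)
  have zN: "z * (z - 2 * X) = - N"
    by (simp add: z_def X_def N_def complex_eq_iff power2_eq_square algebra_simps)
  let ?Xm = "X_matrix a m"
  have Xm: "?Xm *v vector [p, r, s] = vector [M * p - B * r + A^2 * s, B * (p - s), - (A^2) * p + B * r - M * s]"
    for p r s
    unfolding X_matrix_mult_vec by (simp add: A_def B_def M_def)
  define v where "v = (vector [4 * A * Q, 1 - (M + A^2) * X + 4 * A^2 * (M + A^2) * Q, - (2 * B) * X + 4 * A * Q] :: complex^3)"
  have v1: "?Xm *v v = vector [- B + X * ((M - A^2) * B), 2 * B^2 * X, B + X * ((M - A^2) * B)]"
    unfolding v_def Xm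
  proof (intro arg_cong[of _ _ vector] list.inject[THEN iffD2] conjI refl)
    show "M * (4 * A * Q) - B * (1 - (M + A^2) * X + 4 * A^2 * (M + A^2) * Q) + A^2 * (- (2 * B) * X + 4 * A * Q)
      = - B + X * ((M - A^2) * B)" using AB by algebra
    show "B * (4 * A * Q - (- (2 * B) * X + 4 * A * Q)) = 2 * B^2 * X" by algebra
    show "- (A^2) * (4 * A * Q) + B * (1 - (M + A^2) * X + 4 * A^2 * (M + A^2) * Q) - M * (- (2 * B) * X + 4 * A * Q)
      = B + X * ((M - A^2) * B)" using AB by algebra
  qed
  have v2: "?Xm *v (?Xm *v v) = vector [- ((M - A^2) * B), - (2 * B^2), - ((M - A^2) * B)]"
    unfolding v1 Xm
  proof (intro arg_cong[of _ _ vector] list.inject[THEN iffD2] conjI refl)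
    show "M * (- B + X * ((M - A^2) * B)) - B * (2 * B^2 * X) + A^2 * (B + X * ((M - A^2) * B)) = - ((M - A^2) * B)"
      using AB M2 by algebra
    show "B * (- B + X * ((M - A^2) * B) - (B + X * ((M - A^2) * B))) = - (2 * B^2)" by algebra
    show "- (A^2) * (- B + X * ((M - A^2) * B)) + B * (2 * B^2 * X) - M * (B + X * ((M - A^2) * B)) = - ((M - A^2) * B)"
      using AB M2 by algebra
  qed
  let ?Y = "cscale z ?Xm"
  have Y: "?Y *v w = z *s (?Xm *v w)" for w by (rule cscale_mult_vec)
  have nil: "?Y ** (?Y ** ?Y) = 0"
  proof (rule matrix_eq_if_mult_vec_eq)
    fix w
    show "(?Y ** (?Y ** ?Y)) *v w = 0 *v w"
      using X_matrix_nilpotent[OF _ m, of w] a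
      by (simp add: matrix_vector_mul_assoc[symmetric] Y vector_scalar_commute matrix_vector_mult_0)
  qed
  have "mat_exp ?Y *v (k *s v) = k *s (v + z *s (?Xm *v v) + (z^2 / 2) *s (?Xm *v (?Xm *v v)))"
    unfolding mat_exp_nilpotent[OF nil] cscale_mult_vec matrix_vector_mul_assoc[symmetric] Y
    by (simp add: vector_scalar_commute vec_eq_iff algebra_simps power2_eq_square)
  also have "v + z *s (?Xm *v v) + (z^2 / 2) *s (?Xm *v (?Xm *v v)) =
     vector [4 * A * Q - z * B + N * (M - A^2) * B / 2,
        1 - (M + A^2) * X + 4 * A^2 * (M + A^2) * Q + N * B^2,
        - (2 * B) * X + 4 * A * Q + z * B + N * (M - A^2) * B / 2]"
    unfolding v2 unfolding v1 unfolding v_def scale_vector3 add_vector3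
  proof (intro arg_cong[of _ _ vector] list.inject[THEN iffD2] conjI refl)
    have N: "N = 2 * (z * X) - z^2" using zN by algebra
    show "4 * A * Q + z * (- B + X * ((M - A^2) * B)) + z^2 / 2 * - ((M - A^2) * B)
      = 4 * A * Q - z * B + N * (M - A^2) * B / 2"
      unfolding N by (simp add: field_simps)
    show "1 - (M + A^2) * X + 4 * A^2 * (M + A^2) * Q + z * (2 * B^2 * X) + z^2 / 2 * - (2 * B^2)
      = 1 - (M + A^2) * X + 4 * A^2 * (M + A^2) * Q + N * B^2"
      unfolding N by (simp add: field_simps)
    show "- (2 * B) * X + 4 * A * Q + z * (B + X * ((M - A^2) * B)) + z^2 / 2 * - ((M - A^2) * B)
      = - (2 * B) * X + 4 * A * Q + z * B + N * (M - A^2) * B / 2"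
      unfolding N by (simp add: field_simps)
  qed
  finally show ?thesis
    unfolding v_def by (simp add: B_def z_def power_divide mult.commute[of 2 A])
qed

lemma T_matrix_mult_vec:
  defines "s \<equiv> complex_of_real (sqrt 3)"
  shows "T_matrix *v vector [u1, u2, u3] = vector [(u1 + u2 + u3) / s,
     (u2 - (u1 + u3) / 2 + \<i> * s * (u1 - u3) / 2) / s,
     (u2 - (u1 + u3) / 2 - \<i> * s * (u1 - u3) / 2) / s]"
proof -
  define w where "w = exp (2 * of_real pi * \<i> / 3)"
  have "w = cis (2 * pi / 3)" by (simp add: w_def cis_conv_exp mult_ac)
  then have w: "w = (- 1 + \<i> * s) / 2"
    by (simp add: s_def complex_eq_iff cos_120 sin_120)
  have s2: "s * s = 3" by (simp add: s_def flip: of_real_mult)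
  have w2: "w^2 = (- 1 - \<i> * s) / 2"
  proof -
    have "w^2 = (1 - 2 * \<i> * s + (\<i> * \<i>) * (s * s)) / 4" unfolding w by (simp add: power2_eq_square field_simps)
    then have "2 * (2 * w^2) = 2 * (- 1 - \<i> * s)" unfolding s2 by (simp add: algebra_simps)
    then have "2 * w^2 = - 1 - \<i> * s" by (simp only: mult_cancel_left) simp
    then show ?thesis by (simp add: mult.commute)
  qed
  show ?thesis
    unfolding T_matrix_def Let_def w_def[symmetric] w2 cscale_mult_vec vector3_mult_vec scale_vector3
      s_def[symmetric]
    unfolding w by (intro arg_cong[of _ _ vector] list.inject[THEN iffD2] conjI refl)
      (simp_all add: field_simps)
qed

section \<open>Explicit formula for the surface\<close>

theorem proposition4p9:
  fixes a m :: real and \<omega>1 \<omega>2 \<alpha> \<beta> :: complex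
    and Phi :: "complex \<Rightarrow> complex^3^3" and q :: "complex \<Rightarrow> complex"
    and x y :: real
  defines "wp \<equiv> weierstrass_p \<omega>1 \<omega>2"
    and "\<zeta> \<equiv> weierstrass_zeta \<omega>1 \<omega>2"
    and "\<sigma> \<equiv> weierstrass_sigma \<omega>1 \<omega>2"
    and "\<Lambda> \<equiv> period_lattice \<omega>1 \<omega>2"
    and "f \<equiv> surface a m Phi"
  defines "A2 \<equiv> of_real ((m + a^2 + 2 / a) * (m - a^2)) * \<sigma> \<beta>
                  / (2 * of_real (sqrt 3) * \<sigma> (\<beta> - \<alpha>))"
    and "C2 \<equiv> of_real ((m + a^2 - 1 / a) * (m - a^2)) * \<sigma> \<beta>
                  / (2 * of_real (sqrt 3) * \<sigma> (\<beta> - \<alpha>))"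
    and "D2 \<equiv> \<sigma> \<beta> / (of_real a * \<sigma> (\<beta> - \<alpha>))"
    and "B2 \<equiv> (\<lambda>x::real. \<sigma> \<beta> / (of_real (sqrt 3) * \<sigma> (\<beta> - \<alpha>)) *
                  (1 - of_real ((m + a^2 + 2 / a) * x)
                   + of_real (4 * a^2 * (m + a^2 + 2 / a)) * q (of_real x)
                     * (\<sigma> (\<beta> - \<alpha>) / \<sigma> \<beta>) ^ 3))"
    and "E2 \<equiv> (\<lambda>x::real. \<sigma> \<beta> / (of_real (sqrt 3) * \<sigma> (\<beta> - \<alpha>)) *
                  (1 - of_real ((m + a^2 - 1 / a) * x)
                   + of_real (4 * a^2 * (m + a^2 - 1 / a)) * q (of_real x)
                     * (\<sigma> (\<beta> - \<alpha>) / \<sigma> \<beta>) ^ 3))"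
    and "R \<equiv> (\<lambda>x::real. \<sigma> (of_real x + \<beta> - \<alpha>) / \<sigma> (of_real x + \<beta>) * exp (\<zeta> \<alpha> * of_real x))"
  assumes "a > 0"
    and "(m^2 - a^4 - 2 / a^2) / 3 = 0"
    and "fundamental_periods \<omega>1 \<omega>2"
    and "\<And>z. z \<notin> \<Lambda> \<Longrightarrow> (deriv wp z)^2 = 4 * (wp z)^3 + 16"
    and "\<beta> \<notin> \<Lambda>" and "wp \<beta> = of_real (2 / a^2)" and "deriv wp \<beta> = of_real (4 * m / a^2)"
    and "\<alpha> \<notin> \<Lambda>" and "wp \<alpha> = 0" and "deriv wp \<alpha> = 4"
    and "is_frame \<omega>1 \<omega>2 \<beta> a Phi"
    and "is_q \<omega>1 \<omega>2 \<alpha> \<beta> q"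
    and "complex_of_real x \<notin> Lambda_tilde \<omega>1 \<omega>2 \<beta>"
  shows "f (Complex x y) = vector [
           R x * (A2 * of_real (x^2 + y^2) + B2 x),
           R x * (C2 * of_real (x^2 + y^2) + D2 * of_real y + E2 x),
           R x * (C2 * of_real (x^2 + y^2) - D2 * of_real y + E2 x)]"
proof -
  interpret W: equianharmonic \<omega>1 \<omega>2 \<alpha>
    using assms by unfold_locales (simp_all add: wp_def \<Lambda>_def)
  note a = assms(12) and beta = assms(16-18)[unfolded wp_def \<Lambda>_def]
    and frame = assms(22) and q = assms(23) and x = assms(24)
  have m: "m^2 = a^4 + 2 / a^2" using assms(13) by simp
  define A M X N g s where "A = complex_of_real a" and "M = complex_of_real m"
    and "X = complex_of_real x" and "N = complex_of_real (x^2 + y^2)"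
    and "g = W.lame \<beta> 0" and "s = complex_of_real (sqrt 3)"
  define Q where "Q = g^3 * q X"
  have A0: "A \<noteq> 0" using a by (simp add: A_def)
  have s0: "s \<noteq> 0" by (simp add: s_def)
  have zero: "0 \<notin> Lambda_tilde \<omega>1 \<omega>2 \<beta>"
    using beta a by (simp add: Lambda_tilde_def)
  have g0: "g \<noteq> 0" unfolding g_def by (rule W.lame_nonzero[OF zero])
  have g: "\<sigma> (\<beta> - \<alpha>) / \<sigma> \<beta> = g" by (simp add: g_def W.lame_def \<sigma>_def)
  have ginv: "c * \<sigma> \<beta> / (d * \<sigma> (\<beta> - \<alpha>)) = c / d / g" "\<sigma> \<beta> / (d * \<sigma> (\<beta> - \<alpha>)) = 1 / d / g" for c d
    by (simp_all add: g[symmetric])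
  have R: "R x = W.lame \<beta> X" by (simp add: R_def W.lame_def X_def \<sigma>_def \<zeta>_def)
  \<comment> \<open>The vector \<open>(u1, u2, u3)\<close> is the surface before the base change, up to the scalar factor \<open>G(x) / G(0)\<close>.\<close>
  define u1 u2 u3 where "u1 = 4 * A * Q - Complex x y / A + N * (M - A^2) / (2 * A)"
    and "u2 = 1 - (M + A^2) * X + 4 * A^2 * (M + A^2) * Q + N / A^2"
    and "u3 = - (2 / A) * X + 4 * A * Q + Complex x y / A + N * (M - A^2) / (2 * A)"
  have "f (Complex x y) = T_matrix *v (mat_exp (cscale (Complex x y) (X_matrix a m)) *v (Phi X *v vector [0, 1, 0]))"
    by (simp add: f_def surface_def X_def matrix_vector_mul_assoc matrix_mul_assoc)
  also have "Phi X *v vector [0, 1, 0] = (W.lame \<beta> X / g) *s vector [4 * A * Q,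
    1 - (M + A^2) * X + 4 * A^2 * (M + A^2) * Q, - (2 / A) * X + 4 * A * Q]"
    using W.frame_second_column[OF a m beta frame q x] by (simp only: A_def M_def Q_def g_def X_def)
  also have "mat_exp (cscale (Complex x y) (X_matrix a m)) *v ((W.lame \<beta> X / g) *s vector [4 * A * Q,
    1 - (M + A^2) * X + 4 * A^2 * (M + A^2) * Q, - (2 / A) * X + 4 * A * Q])
    = (W.lame \<beta> X / g) *s vector [u1, u2, u3]"
    unfolding A_def M_def X_def N_def u1_def u2_def u3_def by (rule exp_z_is_quadratic[OF a m])
  also have "T_matrix *v ((W.lame \<beta> X / g) *s vector [u1, u2, u3]) = (W.lame \<beta> X / g) *s (T_matrix *v vector [u1, u2, u3])"
    by (rule vector_scalar_commute)
  finally have f: "f (Complex x y) = vector [W.lame \<beta> X / g * ((u1 + u2 + u3) / s),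
     W.lame \<beta> X / g * ((u2 - (u1 + u3) / 2 + \<i> * s * (u1 - u3) / 2) / s),
     W.lame \<beta> X / g * ((u2 - (u1 + u3) / 2 - \<i> * s * (u1 - u3) / 2) / s)]"
    unfolding T_matrix_mult_vec scale_vector3 s_def .
  define B where "B = 1 / A"
  have AB: "A * B = 1" using A0 by (simp add: B_def)
  have M2: "M^2 = A^4 + 2 * B^2"
    using arg_cong[OF m, of complex_of_real] by (simp add: A_def B_def M_def power_divide)
  have z: "Complex x y = X + \<i> * complex_of_real y" by (simp add: X_def Complex_eq)
  have A2: "A2 = (M + A^2 + 2 * B) * (M - A^2) / (2 * s) / g"
    and C2: "C2 = (M + A^2 - B) * (M - A^2) / (2 * s) / g"
    and D2: "D2 = B / g"
    unfolding A2_def C2_def D2_def ginv by (simp_all add: A_def B_def M_def s_def)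
  have q3: "c * q X * (\<sigma> (\<beta> - \<alpha>) / \<sigma> \<beta>)^3 = c * Q" for c
    unfolding g by (simp add: Q_def mult_ac)
  have B2: "B2 x = (1 - (M + A^2 + 2 * B) * X + 4 * A^2 * (M + A^2 + 2 * B) * Q) / s / g"
    and E2: "E2 x = (1 - (M + A^2 - B) * X + 4 * A^2 * (M + A^2 - B) * Q) / s / g"
    unfolding B2_def E2_def ginv X_def[symmetric] q3 by (simp_all add: A_def B_def M_def s_def X_def)
  have u13: "u1 + u3 = 8 * A * Q - 2 * B * X + N * (M - A^2) * B" "u1 - u3 = 2 * B * (X - Complex x y)"
  proof -
    define H where "H = N * (M - A^2) * B / 2"
    have H: "N * (M - A^2) * B = 2 * H" by (simp add: H_def)
    have "u1 = 4 * A * Q - Complex x y * B + H" "u3 = - (2 * B) * X + 4 * A * Q + Complex x y * B + H"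
      by (simp_all add: u1_def u3_def H_def B_def mult.commute[of 2 A])
    then show "u1 + u3 = 8 * A * Q - 2 * B * X + N * (M - A^2) * B" "u1 - u3 = 2 * B * (X - Complex x y)"
      unfolding H by (simp_all add: algebra_simps)
  qed
  have u2: "u2 = 1 - (M + A^2) * X + 4 * A^2 * (M + A^2) * Q + N * B^2"
    by (simp add: u2_def B_def power_divide)
  \<comment> \<open>The entries \<open>u1\<close> and \<open>u3\<close> differ only by the term in \<open>y\<close>; this is why \<open>y\<close> enters the last two coordinates with opposite signs.\<close>
  have e1: "u1 + u2 + u3 = (M + A^2 + 2 * B) * (M - A^2) / 2 * N
      + (1 - (M + A^2 + 2 * B) * X + 4 * A^2 * (M + A^2 + 2 * B) * Q)"
  proof -
    have "2 * (u2 + (u1 + u3)) = (M + A^2 + 2 * B) * (M - A^2) * N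
      + 2 * (1 - (M + A^2 + 2 * B) * X + 4 * A^2 * (M + A^2 + 2 * B) * Q)"
      unfolding u13 u2 using AB M2 by algebra
    then show ?thesis by (simp add: field_simps)
  qed
  have e2: "u2 - (u1 + u3) / 2 = (M + A^2 - B) * (M - A^2) / 2 * N
      + (1 - (M + A^2 - B) * X + 4 * A^2 * (M + A^2 - B) * Q)"
  proof -
    have "2 * u2 - (u1 + u3) = (M + A^2 - B) * (M - A^2) * N
      + 2 * (1 - (M + A^2 - B) * X + 4 * A^2 * (M + A^2 - B) * Q)"
      unfolding u13 u2 using AB M2 by algebra
    moreover have "p - r / 2 = c / 2 * N + d" if "2 * p - r = c * N + 2 * d" for p r c d :: complex
      using that by (simp add: field_simps)
    ultimately show ?thesis by blast
  qed
  have e3: "\<i> * s * (u1 - u3) / 2 = s * B * complex_of_real y"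
    unfolding u13 z by (simp add: algebra_simps)
  have "k / g * ((p / 2 * N + d) / s) = k * (p / (2 * s) / g * N + d / s / g)"
    "k / g * ((p / 2 * N + d + s * B * Y) / s) = k * (p / (2 * s) / g * N + B / g * Y + d / s / g)"
    "k / g * ((p / 2 * N + d - s * B * Y) / s) = k * (p / (2 * s) / g * N - B / g * Y + d / s / g)"
    for k p d Y
    using s0 g0 by (simp_all add: field_simps)
  then show ?thesis
    unfolding f R A2 B2 C2 D2 E2 e1 e2 e3 N_def[symmetric] by simp
qed

end
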